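(* Let $A$ be a symmetric real $p\times p$ matrix, $B$ a symmetric positive definite real $p\times p$ matrix, and $1\le k<p$. Let $(V^\ast,\rho^\ast)$ be the solution of the trace ratio problem for $(A,B)$, and assume $\lambda_k(A-\rho^\ast B)>\lambda_{k+1}(A-\rho^\ast B)$. For a matrix $U$ with orthonormal columns, of size $p\times j$ with $k\le j\le p$, let $\rho$ be the maximum value of the trace ratio problem projected onto $\mathcal U=\operatorname{span}(U)$, let $H=U^TAU$, $K=U^TBU$, and let $\theta=\angle(\mathcal U,\operatorname{span}(V^\ast))\in[0,\pi/2]$. Then there exists a subset of $k$ eigenvalues of $H-\rho K$ converging to the $k$ largest eigenvalues of $A-\rho^\ast B$ as $\theta\to0$. That is, for every $\varepsilon>0$ there is $\delta>0$ such that for every such $U$ with $\theta<\delta$ there are distinct indices $\pi_1,\dots,\pi_k\in\{1,\dots,j\}$ with $|\lambda_{\pi_i}(H-\rho K)-\lambda_i(A-\rho^\ast B)|<\varepsilon$ for $i=1,\dots,k$.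
   Context: The trace ratio problem for $(A,B)$ is $\max_{V\in\mathbb R^{p\times k},\,V^TV=I_k}\rho(V)$, with $\rho(V)=\operatorname{tr}(V^TAV)/\operatorname{tr}(V^TBV)$; its solution $(V^\ast,\rho^\ast)$ consists of a maximizer $V^\ast$ ($p\times k$, orthonormal columns) and the maximum value $\rho^\ast$. Eigenvalues of a symmetric matrix $S$ are listed with multiplicity in non-increasing order $\lambda_1(S)\ge\lambda_2(S)\ge\cdots$. The trace ratio problem projected onto $\mathcal U=\operatorname{span}(U)$ is $\rho=\max_{V=UZ,\ V^TV=I_k}\rho(V) = \max_{Z\in\mathbb R^{j\times k},\,Z^TZ=I_k}\operatorname{tr}(Z^TU^TAUZ)/\operatorname{tr}(Z^TU^TBUZ)$. The angle $\theta$ is defined by $\sin\theta=\|U_\perp^TV^\ast\|$ (spectral norm), where the columns of $U_\perp$ form an orthonormal basis of the orthogonal complement of $\mathcal U$ (and $\sin\theta=0$ if $j=p$). *)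

theory Defs
  imports Complex_Main "Jordan_Normal_Form.Char_Poly" "Jordan_Normal_Form.VS_Connect"
begin

definition symmetric_real_mat :: "nat \<Rightarrow> real mat \<Rightarrow> bool" where
  "symmetric_real_mat n S \<longleftrightarrow> S \<in> carrier_mat n n \<and> transpose_mat S = S"

definition pos_def_mat :: "nat \<Rightarrow> real mat \<Rightarrow> bool" where
  "pos_def_mat n S \<longleftrightarrow> symmetric_real_mat n S \<and>
     (\<forall>x \<in> carrier_vec n. x \<noteq> 0\<^sub>v n \<longrightarrow> x \<bullet> (S *\<^sub>v x) > 0)"

definition mat_trace :: "real mat \<Rightarrow> real" where
  "mat_trace M = (\<Sum>i<dim_row M. M $$ (i, i))"

text \<open>Real roots of the characteristic polynomial, listed with multiplicity in non-increasing
  order and indexed from 1. For a symmetric matrix the characteristic polynomial splits over the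
  reals, so the list has exactly as many entries as the matrix has rows; outside that index range
  the value is meaningless.\<close>

definition eigval :: "nat \<Rightarrow> real mat \<Rightarrow> real" where
  "eigval i S = rev (sorted_list_of_multiset (proots (char_poly S))) ! (i - 1)"

definition orthonormal_cols :: "nat \<Rightarrow> nat \<Rightarrow> real mat set" where
  "orthonormal_cols n m = {V \<in> carrier_mat n m. transpose_mat V * V = 1\<^sub>m m}"

definition trace_ratio :: "real mat \<Rightarrow> real mat \<Rightarrow> real mat \<Rightarrow> real" where
  "trace_ratio A B V =
     mat_trace (transpose_mat V * A * V) / mat_trace (transpose_mat V * B * V)"

definition solves_trace_ratio ::
    "real mat \<Rightarrow> real mat \<Rightarrow> real mat set \<Rightarrow> real mat \<Rightarrow> real \<Rightarrow> bool" where
  "solves_trace_ratio A B F V r \<longleftrightarrow>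
     is_arg_max (trace_ratio A B) (\<lambda>W. W \<in> F) V \<and> r = trace_ratio A B V"

definition trace_ratio_solution ::
    "nat \<Rightarrow> nat \<Rightarrow> real mat \<Rightarrow> real mat \<Rightarrow> real mat \<Rightarrow> real \<Rightarrow> bool" where
  "trace_ratio_solution p k A B V r \<longleftrightarrow> solves_trace_ratio A B (orthonormal_cols p k) V r"

definition projected_trace_ratio_max ::
    "nat \<Rightarrow> nat \<Rightarrow> real mat \<Rightarrow> real mat \<Rightarrow> real mat \<Rightarrow> real \<Rightarrow> bool" where
  "projected_trace_ratio_max p k A B U r \<longleftrightarrow>
     (\<exists>V. solves_trace_ratio A B
        {V \<in> orthonormal_cols p k. \<exists>Z \<in> carrier_mat (dim_col U) k. V = U * Z} V r)"

definition euclid_norm :: "real vec \<Rightarrow> real" where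
  "euclid_norm x = sqrt (x \<bullet> x)"

text \<open>The unit ball is used instead of the unit sphere so that the supremum is taken over a
  nonempty set for every format; a matrix without rows has norm 0.\<close>

definition spectral_norm :: "real mat \<Rightarrow> real" where
  "spectral_norm M =
     (SUP x \<in> {x \<in> carrier_vec (dim_col M). euclid_norm x \<le> 1}. euclid_norm (M *\<^sub>v x))"

definition orth_complement :: "nat \<Rightarrow> real vec set \<Rightarrow> real vec set" where
  "orth_complement n S = {x \<in> carrier_vec n. \<forall>s \<in> S. s \<bullet> x = 0}"

text \<open>The angle does not depend on the choice of the orthonormal basis of the complement.
  If the columns of U span the whole space, that basis is empty and the angle is 0.\<close>

definition subspace_angle :: "nat \<Rightarrow> real mat \<Rightarrow> real mat \<Rightarrow> real \<Rightarrow> bool" where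
  "subspace_angle p U V \<theta> \<longleftrightarrow> 0 \<le> \<theta> \<and> \<theta> \<le> pi / 2 \<and>
     (\<exists>m. \<exists>U' \<in> orthonormal_cols p m.
        vec_space.col_space p U' = orth_complement p (vec_space.col_space p U) \<and>
        sin \<theta> = spectral_norm (transpose_mat U' * V))"

end

(* Write M = A - rho* B and N = U^T (A - rho B) U, with lambda_i and nu_i their eigenvalues; the
   indices pi_i = i work. Maximality of rho* and rho gives lambda_1 + ... + lambda_k = 0 and
   nu_1 + ... + nu_k <= 0, and rho <= rho*. Courant-Fischer gives the upper bound
   nu_i <= lambda_i + (rho* - rho) |B|. It also gives a lower bound: the compression V*^T M V* has
   the eigenvalues lambda_1, ..., lambda_k, and replacing x in the range of V* by its projection
   U U^T x moves it by at most sin(theta) |x|, so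
   nu_i >= lambda_i - L sin(theta) + (rho* - rho) b with b > 0 a lower bound for B. Summing the
   lower bounds over i <= k forces rho* - rho <= L sin(theta) / b, and then both bounds differ from
   lambda_i by O(theta). *)
theory Submission
  imports Defs "Jordan_Normal_Form.Schur_Decomposition"
begin

text \<open>Nothing bounds rho* - rho in advance. Estimating it directly would call for a feasible
  competitor in the range of U close to V*, that is, an orthonormalization of U U^T V*. Keeping the
  gain (rho* - rho) b in the lower bound replaces this: the unknown is bounded by the very estimates
  in which it occurs. For the summation all k bounds need a common error constant, and for a uniform
  delta that constant may depend on A, B and rho* but not on U or j. V* is an arbitrary maximizer,
  not a given frame of eigenvectors of M, so the eigenvalues of its compression are what is carried
  over to U. Accordingly, every eigenvalue inequality between different matrices comes from one
  comparison principle, \<open>eigval_le_of_form_le\<close>, along a suitable linear map. Since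
  \<open>eigval\<close> reads off roots of the characteristic polynomial, its link to quadratic
  forms is an orthogonal diagonalization with the diagonal in the same order.\<close>

section \<open>Orthogonal diagonalization of real symmetric matrices\<close>

lemma symmetric_scalar_prod_mult:
  fixes S :: "'a :: comm_semiring_0 mat"
  assumes S: "S \<in> carrier_mat n n" "S\<^sup>T = S" and x: "x \<in> carrier_vec n" and y: "y \<in> carrier_vec n"
  shows "(S *\<^sub>v x) \<bullet> y = x \<bullet> (S *\<^sub>v y)"
  using transpose_vec_mult_scalar[of S n n y x] S x y by (simp add: comm_scalar_prod[of _ n])

lemma map_poly_of_real_prod_list:
  "map_poly complex_of_real (\<Prod>e\<leftarrow>es. [:- e, 1:]) = (\<Prod>e\<leftarrow>es. [:- complex_of_real e, 1:])"
proof -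
  interpret of_real: map_poly_inj_idom_hom complex_of_real ..
  show ?thesis by (induct es) (auto simp: hom_distribs simp del: mult_pCons_left)
qed

text \<open>The polynomial factors over the complex numbers. Pairing \<open>S\<close> v = a v with
  the conjugate of v and moving the real symmetric \<open>S\<close> across the product gives a =
  \<open>cnj a\<close>. So all roots are real, and the factorization descends along the injective
  embedding of real polynomials.\<close>

lemma char_poly_symmetric_splits:
  fixes S :: "real mat"
  assumes S: "S \<in> carrier_mat n n" "S\<^sup>T = S"
  shows "\<exists>es. char_poly S = (\<Prod>e\<leftarrow>es. [:- e, 1:])"
proof -
  let ?C = "map_mat complex_of_real S"
  have C: "?C \<in> carrier_mat n n" using S by simp
  have Ct: "?C\<^sup>T = ?C" using S(2) S(1)
    by (metis map_mat_transpose)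
  obtain as where as: "char_poly ?C = (\<Prod>a\<leftarrow>as. [:- a, 1:])"
    using char_poly_factorized[OF C] by auto
  have real: "of_real (Re a) = a" if a: "a \<in> set as" for a
  proof -
    have "poly (char_poly ?C) a = 0"
      unfolding as poly_prod_list using a by (auto simp: prod_list_zero_iff o_def)
    then obtain v where v: "v \<in> carrier_vec n" "v \<noteq> 0\<^sub>v n" "?C *\<^sub>v v = a \<cdot>\<^sub>v v"
      using eigenvalue_root_char_poly[OF C] C by (auto simp: eigenvalue_def eigenvector_def)
    have "?C *\<^sub>v conjugate v = conjugate (?C *\<^sub>v v)"
      using C v(1) by (intro eq_vecI) (auto simp: scalar_prod_def conjugate_complex_def)
    then have cv: "?C *\<^sub>v conjugate v = cnj a \<cdot>\<^sub>v conjugate v"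
      by (simp add: v(3) conjugate_smult_vec conjugate_complex_def)
    have "a * (v \<bullet>c v) = (?C *\<^sub>v v) \<bullet>c v" using v by simp
    also have "\<dots> = v \<bullet> (?C *\<^sub>v conjugate v)"
      using symmetric_scalar_prod_mult[OF C Ct v(1), of "conjugate v"] v(1) by simp
    also have "\<dots> = cnj a * (v \<bullet>c v)" using v by (simp add: cv)
    finally have "a = cnj a" using v by auto
    then show ?thesis by (simp add: complex_eq_iff)
  qed
  define es where "es = map Re as"
  have eq: "map_poly of_real (char_poly S) = map_poly complex_of_real (\<Prod>e\<leftarrow>es. [:- e, 1:])"
  proof -
    have "map_poly of_real (char_poly S) = char_poly ?C"
      by (rule of_real_hom.char_poly_hom[OF S(1), symmetric])
    also have "\<dots> = (\<Prod>a\<leftarrow>as. [:- complex_of_real (Re a), 1:])"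
      unfolding as using real by (intro arg_cong[of _ _ prod_list] map_cong) auto
    finally show ?thesis
      unfolding map_poly_of_real_prod_list unfolding es_def map_map o_def .
  qed
  interpret of_real: map_poly_inj_idom_hom complex_of_real ..
  show ?thesis using eq by auto
qed

text \<open>Supplies the change of basis that splits off one eigenvector. Gram-Schmidt on a basis
  starting with \<open>v\<close> leaves \<open>v\<close> in first place; its output is orthogonal
  but not normalized, and \<open>c\<close> is the normalizing factor of the first vector.\<close>

lemma ex_orthonormal_mat_first_col:
  fixes v :: "real vec"
  assumes v: "v \<in> carrier_vec n" and v0: "v \<noteq> 0\<^sub>v n"
  shows "\<exists>W c. W \<in> carrier_mat n n \<and> W\<^sup>T * W = 1\<^sub>m n \<and> col W 0 = c \<cdot>\<^sub>v v"
proof -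
  have n: "0 < n" using v v0 by (cases n) auto
  define b where "b = basis_completion v"
  define ws where "ws = gram_schmidt n b"
  interpret cof_vec_space n "TYPE(real)" .
  from basis_completion[OF v v0, folded b_def]
  have dist_b: "distinct b" and indep: "\<not> lin_dep (set b)" and b: "set b \<subseteq> carrier_vec n"
    and hdb: "hd b = v" and len_b: "length b = n" by auto
  obtain vs where bv: "b = v # vs" using hdb len_b n by (cases b) auto
  from gram_schmidt_result[OF b dist_b indep refl, folded ws_def]
  have ws: "set ws \<subseteq> carrier_vec n" "corthogonal ws" "length ws = n" by (auto simp: len_b)
  have hdws: "ws ! 0 = v"
    using gram_schmidt_hd[OF v, of vs, folded bv] ws(3) n unfolding ws_def by (metis hd_conv_nth list.size(3) less_irrefl)
  have wc: "ws ! i \<in> carrier_vec n" if "i < n" for i using ws that by auto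
  have orth: "ws ! i \<bullet> ws ! j = 0 \<longleftrightarrow> i \<noteq> j" if "i < n" "j < n" for i j
    using corthogonalD[OF ws(2), of i j] that ws(3) by simp
  define f where "f i = 1 / sqrt (ws ! i \<bullet> ws ! i)" for i
  define W where "W = mat_of_cols n (map (\<lambda>i. f i \<cdot>\<^sub>v ws ! i) [0..<n])"
  have W: "W \<in> carrier_mat n n" by (simp add: W_def mat_of_cols_def)
  have col: "col W i = f i \<cdot>\<^sub>v ws ! i" if "i < n" for i
    unfolding W_def using that wc[OF that] by (subst col_mat_of_cols) auto
  have "W\<^sup>T * W = 1\<^sub>m n"
  proof (rule eq_matI)
    fix i j assume "i < dim_row (1\<^sub>m n :: real mat)" "j < dim_col (1\<^sub>m n :: real mat)"
    then have ij: "i < n" "j < n" by auto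
    have "(W\<^sup>T * W) $$ (i, j) = f i * f j * (ws ! i \<bullet> ws ! j)"
      using ij W wc[OF ij(1)] wc[OF ij(2)] by (simp add: col)
    moreover have "ws ! i \<bullet> ws ! i > 0"
      using orth[OF ij(1) ij(1)] by (simp add: scalar_prod_def sum_nonneg order_less_le)
    ultimately show "(W\<^sup>T * W) $$ (i, j) = 1\<^sub>m n $$ (i, j)"
      using orth[OF ij] ij by (auto simp: f_def real_sqrt_mult_self)
  qed (use W in auto)
  then show ?thesis using W col[OF n] hdws by auto
qed

lemma orthonormal_cols_mult:
  assumes "V \<in> orthonormal_cols n m" "W \<in> orthonormal_cols m l"
  shows "V * W \<in> orthonormal_cols n l"
proof -
  have V: "V \<in> carrier_mat n m" "V\<^sup>T * V = 1\<^sub>m m" and W: "W \<in> carrier_mat m l" "W\<^sup>T * W = 1\<^sub>m l"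
    using assms by (auto simp: orthonormal_cols_def)
  have "(V * W)\<^sup>T * (V * W) = W\<^sup>T * ((V\<^sup>T * V) * W)"
    using V(1) W(1) by (simp add: transpose_mult[OF V(1) W(1)] assoc_mult_mat[of _ _ n _ m _ l]
        assoc_mult_mat[of "W\<^sup>T" l m "V\<^sup>T" n "V * W" l])
  then show ?thesis using V W by (auto simp: orthonormal_cols_def)
qed

lemma congruence_mult:
  fixes S :: "'a :: comm_semiring_1 mat"
  assumes "S \<in> carrier_mat n n" "V \<in> carrier_mat n m" "W \<in> carrier_mat m l"
  shows "(V * W)\<^sup>T * S * (V * W) = W\<^sup>T * (V\<^sup>T * S * V) * W"
proof -
  have "(V * W)\<^sup>T * S * (V * W) = (W\<^sup>T * V\<^sup>T) * S * (V * W)"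
    using assms by (simp add: transpose_mult)
  also have "\<dots> = W\<^sup>T * (V\<^sup>T * (S * (V * W)))"
    using assms by (simp add: assoc_mult_mat[of _ l n _ n _ l] assoc_mult_mat[of _ l m _ n _ l]
        assoc_mult_mat[of _ m n _ n _ l])
  also have "\<dots> = W\<^sup>T * (V\<^sup>T * S * V) * W"
    using assms by (simp add: assoc_mult_mat[of _ l m _ m _ l] assoc_mult_mat[of _ m n _ m _ l]
        assoc_mult_mat[of _ m n _ n _ l] assoc_mult_mat[of _ n n _ m _ l] assoc_mult_mat[of _ m n _ n _ m])
  finally show ?thesis .
qed

lemma symmetric_congruence:
  fixes S :: "'a :: comm_semiring_1 mat"
  assumes S: "S \<in> carrier_mat n n" "S\<^sup>T = S" and V: "V \<in> carrier_mat n m"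
  shows "V\<^sup>T * S * V \<in> carrier_mat m m" "(V\<^sup>T * S * V)\<^sup>T = V\<^sup>T * S * V"
proof -
  show "V\<^sup>T * S * V \<in> carrier_mat m m" using S V by simp
  have "(V\<^sup>T * S * V)\<^sup>T = V\<^sup>T * (V\<^sup>T * S)\<^sup>T"
    using S V by (intro transpose_mult[of _ m n _ m]) auto
  also have "(V\<^sup>T * S)\<^sup>T = S * V"
    using S V transpose_mult[of "V\<^sup>T" m n S n] by simp
  also have "V\<^sup>T * (S * V) = V\<^sup>T * S * V"
    using S V by (intro assoc_mult_mat[symmetric]) auto
  finally show "(V\<^sup>T * S * V)\<^sup>T = V\<^sup>T * S * V" .
qed

text \<open>Deflation, one eigenvector per step. The induction runs over the list of roots, so the
  diagonal appears in whatever order the factorization is given; the sorted list can then be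
  prescribed.\<close>

lemma symmetric_mat_orthogonal_diagonalization:
  fixes S :: "real mat"
  assumes "S \<in> carrier_mat n n" "S\<^sup>T = S" "char_poly S = (\<Prod>e\<leftarrow>es. [:- e, 1:])"
  shows "\<exists>Q\<in>orthonormal_cols n n. Q\<^sup>T * S * Q = mat_diag n (\<lambda>i. es ! i)"
  using assms
proof (induct es arbitrary: n S)
  case Nil
  then have "n = 0" using degree_monic_char_poly[of S n] by auto
  then show ?case using Nil by (intro bexI[of _ "1\<^sub>m 0"]) (auto simp: orthonormal_cols_def mat_diag_def)
next
  case (Cons e es)
  note S = Cons(2,3)
  have cp: "char_poly S = [:- e, 1:] * (\<Prod>e\<leftarrow>es. [:- e, 1:])" using Cons(4) by simp
  have "monic (\<Prod>e\<leftarrow>es. [:- e, 1:])" by (rule monic_prod_list) auto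
  then have "degree (char_poly S) = Suc (degree (\<Prod>e\<leftarrow>es. [:- e, 1:]))" unfolding cp
    by (subst degree_mult_eq) auto
  then obtain m where n: "n = Suc m" using degree_monic_char_poly[OF S(1)] by auto
  have "eigenvalue S e" unfolding eigenvalue_root_char_poly[OF S(1)] cp by simp
  then obtain v where v: "v \<in> carrier_vec n" "v \<noteq> 0\<^sub>v n" "S *\<^sub>v v = e \<cdot>\<^sub>v v"
    using S(1) by (auto simp: eigenvalue_def eigenvector_def)
  obtain W c where W: "W \<in> carrier_mat n n" "W\<^sup>T * W = 1\<^sub>m n" "col W 0 = c \<cdot>\<^sub>v v"
    using ex_orthonormal_mat_first_col[OF v(1,2)] by auto
  define A where "A = W\<^sup>T * S * W"
  have A: "A \<in> carrier_mat n n" "A\<^sup>T = A"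
    using symmetric_congruence[OF S W(1)] by (auto simp: A_def)
  have WW: "W * W\<^sup>T = 1\<^sub>m n" using mat_mult_left_right_inverse[OF _ W(1,2)] W(1) by auto
  have "similar_mat A S"
    unfolding similar_mat_def similar_mat_wit_def Let_def
    using A(1) S W WW by (intro exI[of _ "W\<^sup>T"] exI[of _ W]) (auto simp: A_def)
  then have cpA: "char_poly A = [:- e, 1:] * (\<Prod>e\<leftarrow>es. [:- e, 1:])"
    using cp char_poly_similar by metis
  have Se: "S *\<^sub>v col W 0 = e \<cdot>\<^sub>v col W 0"
    using v S(1) W by (simp add: mult_mat_vec smult_smult_assoc mult.commute)
  have cW: "col W 0 \<in> carrier_vec n" using W(1) by (intro carrier_vecI) simp
  have "col A 0 = W\<^sup>T *\<^sub>v (S *\<^sub>v col W 0)"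
  proof -
    have "col A 0 = W\<^sup>T * S *\<^sub>v col W 0"
      unfolding A_def using W(1) S(1) n by (intro col_mult2[of _ n n _ n]) auto
    also have "\<dots> = W\<^sup>T *\<^sub>v (S *\<^sub>v col W 0)"
      using W(1) S(1) cW by (intro assoc_mult_mat_vec[of _ n n _ n]) auto
    finally show ?thesis .
  qed
  also have "\<dots> = e \<cdot>\<^sub>v col (W\<^sup>T * W) 0"
  proof -
    have "col (W\<^sup>T * W) 0 = W\<^sup>T *\<^sub>v col W 0"
      using W(1) n by (intro col_mult2[of _ n n _ n]) auto
    moreover have "W\<^sup>T *\<^sub>v (e \<cdot>\<^sub>v col W 0) = e \<cdot>\<^sub>v (W\<^sup>T *\<^sub>v col W 0)"
      using W(1) cW by (intro mult_mat_vec[of _ n n]) auto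
    ultimately show ?thesis by (simp only: Se)
  qed
  finally have colA: "col A 0 = e \<cdot>\<^sub>v unit_vec n 0" using n by (simp add: W(2))
  have A0: "A $$ (i, 0) = (if i = 0 then e else 0)" if "i < n" for i
    using arg_cong[OF colA, of "\<lambda>v. v $ i"] that A(1) n by auto
  have A0': "A $$ (0, i) = (if i = 0 then e else 0)" if "i < n" for i
    using A0[OF that] A that by (metis carrier_matD index_transpose_mat(1) n zero_less_Suc)
  define A1 where "A1 = mat 1 1 (\<lambda>_. e)"
  define A3 where "A3 = mat m m (\<lambda>(i,j). A $$ (Suc i, Suc j))"
  have A1: "A1 \<in> carrier_mat 1 1" and A3: "A3 \<in> carrier_mat m m" by (auto simp: A1_def A3_def)
  \<comment> \<open>By symmetry the zeros below the corner in the first column reappear in the first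
    row, so what remains is again a symmetric matrix, of size \<open>m\<close>.\<close>
  have blk: "A = four_block_mat A1 (0\<^sub>m 1 m) (0\<^sub>m m 1) A3"
    using A(1) A0 A0' by (intro eq_matI) (auto simp: A1_def A3_def n)
  have "A $$ (i, j) = A $$ (j, i)" if "i < n" "j < n" for i j
    using A that by (metis carrier_matD index_transpose_mat(1))
  then have A3t: "A3\<^sup>T = A3" by (intro eq_matI) (auto simp: A3_def n)
  have "char_poly A = char_poly A1 * char_poly A3" unfolding blk
    by (rule char_poly_four_block_zeros_col[OF A1 _ A3]) simp
  also have "char_poly A1 = [:- e, 1:]" by (simp add: A1_def char_poly_defs det_def sign_def)
  finally have "char_poly A3 = (\<Prod>e\<leftarrow>es. [:- e, 1:])"
    using cpA by (metis mult_cancel_left pCons_eq_0_iff zero_neq_one)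
  from Cons(1)[OF A3 A3t this] obtain Q where
    Q: "Q \<in> carrier_mat m m" "Q\<^sup>T * Q = 1\<^sub>m m" "Q\<^sup>T * A3 * Q = mat_diag m (\<lambda>i. es ! i)"
    by (auto simp: orthonormal_cols_def)
  define F where "F = four_block_mat (1\<^sub>m 1) (0\<^sub>m 1 m) (0\<^sub>m m 1) Q"
  have F: "F \<in> carrier_mat n n" using Q by (auto simp: F_def n)
  have Ft: "F\<^sup>T = four_block_mat (1\<^sub>m 1) (0\<^sub>m 1 m) (0\<^sub>m m 1) Q\<^sup>T"
    unfolding F_def by (subst transpose_four_block_mat[OF _ _ _ Q(1)]) auto
  have FF: "F\<^sup>T * F = 1\<^sub>m n"
    unfolding Ft unfolding F_def by (subst mult_four_block_mat[of _ 1 1 _ m _ m _ _ 1 _ m]) (use Q n in auto)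
  have "F\<^sup>T * A * F = four_block_mat A1 (0\<^sub>m 1 m) (0\<^sub>m m 1) (Q\<^sup>T * A3 * Q)"
    unfolding Ft blk using Q(1) A1 A3
    by (subst mult_four_block_mat[of _ 1 1 _ m _ m _ _ 1 _ m])
      (auto simp: F_def mult_four_block_mat[of _ 1 1 _ m _ m _ _ 1 _ m])
  also have "\<dots> = mat_diag n (\<lambda>i. (e # es) ! i)"
    unfolding Q(3) by (rule eq_matI) (auto simp: A1_def n mat_diag_def nth_Cons')
  finally have "(W * F)\<^sup>T * S * (W * F) = mat_diag n (\<lambda>i. (e # es) ! i)"
    using congruence_mult[OF S(1) W(1) F] by (simp add: A_def)
  moreover have "W * F \<in> orthonormal_cols n n"
    using W F FF by (intro orthonormal_cols_mult[of _ n n]) (auto simp: orthonormal_cols_def)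
  ultimately show ?case by blast
qed

text \<open>The link from \<open>eigval\<close> to quadratic forms. Matrix positions count from 0
  and eigenvalues from 1, hence \<open>Suc i\<close> on the diagonal.\<close>

lemma symmetric_mat_eigval:
  assumes "symmetric_real_mat n S"
  shows "\<exists>Q\<in>orthonormal_cols n n. Q\<^sup>T * S * Q = mat_diag n (\<lambda>i. eigval (Suc i) S)"
    and "\<And>i j. 1 \<le> i \<Longrightarrow> i \<le> j \<Longrightarrow> j \<le> n \<Longrightarrow> eigval j S \<le> eigval i S"
proof -
  have S: "S \<in> carrier_mat n n" "S\<^sup>T = S" using assms by (auto simp: symmetric_real_mat_def)
  obtain es where es: "char_poly S = (\<Prod>e\<leftarrow>es. [:- e, 1:])"
    using char_poly_symmetric_splits[OF S] by auto
  define xs where "xs = rev (sorted_list_of_multiset (mset es))"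
  have ms: "mset xs = mset es" by (simp add: xs_def)
  have "proots (\<Prod>e\<leftarrow>es. [:- e, 1:]) = mset es"
  proof (induct es)
    case (Cons a es)
    have "(\<Prod>e\<leftarrow>es. [:- e, 1:]) \<noteq> (0 :: real poly)" by (auto simp: prod_list_zero_iff)
    then show ?case using Cons proots_mult[of "[:- a, 1:]"] by (simp del: mult_pCons_left)
  qed simp
  then have ev: "eigval i S = xs ! (i - 1)" for i by (simp add: eigval_def es xs_def)
  \<comment> \<open>The product ignores the order of its factors, so the sorted list is a
    factorization too.\<close>
  have cp: "char_poly S = (\<Prod>e\<leftarrow>xs. [:- e, 1:])"
    unfolding es prod_mset_prod_list[symmetric] mset_map ms ..
  then have len: "length xs = n"
    using degree_monic_char_poly[OF S(1)] degree_linear_factors[of uminus xs] by simp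
  show "\<exists>Q\<in>orthonormal_cols n n. Q\<^sup>T * S * Q = mat_diag n (\<lambda>i. eigval (Suc i) S)"
    using symmetric_mat_orthogonal_diagonalization[OF S cp] by (simp add: ev)
  have "sorted (rev xs)" by (simp add: xs_def)
  then show "eigval j S \<le> eigval i S" if "1 \<le> i" "i \<le> j" "j \<le> n" for i j
    using that len by (auto simp: ev sorted_rev_iff_nth_mono intro!: diff_le_mono)
qed

section \<open>Quadratic forms and the Courant-Fischer comparison\<close>

lemma scalar_prod_mult_mat_vec_left:
  fixes A :: "'a :: comm_semiring_0 mat"
  assumes "A \<in> carrier_mat n m" "x \<in> carrier_vec m" "y \<in> carrier_vec n"
  shows "(A *\<^sub>v x) \<bullet> y = x \<bullet> (A\<^sup>T *\<^sub>v y)"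
  using transpose_vec_mult_scalar[OF assms] assms
  by (simp add: comm_scalar_prod[of _ n] comm_scalar_prod[of _ m])

lemma quadratic_form_mult_mat_vec:
  fixes S :: "'a :: comm_semiring_1 mat"
  assumes "S \<in> carrier_mat n n" "V \<in> carrier_mat n m" "x \<in> carrier_vec m"
  shows "(V *\<^sub>v x) \<bullet> (S *\<^sub>v (V *\<^sub>v x)) = x \<bullet> ((V\<^sup>T * S * V) *\<^sub>v x)"
  using assms by (simp add: scalar_prod_mult_mat_vec_left[of V n m] assoc_mult_mat_vec[of _ m n _ m]
      assoc_mult_mat_vec[of _ m n _ n])

lemma orthonormal_cols_isometry:
  assumes "V \<in> orthonormal_cols n m" "x \<in> carrier_vec m"
  shows "(V *\<^sub>v x) \<bullet> (V *\<^sub>v x) = x \<bullet> x"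
proof -
  have V: "V \<in> carrier_mat n m" "V\<^sup>T * V = 1\<^sub>m m" using assms by (auto simp: orthonormal_cols_def)
  have "V\<^sup>T *\<^sub>v (V *\<^sub>v x) = x"
    using V assms(2) by (simp flip: assoc_mult_mat_vec[of _ m n _ m])
  then show ?thesis using V assms(2) by (simp add: scalar_prod_mult_mat_vec_left[of V n m])
qed

lemma scalar_prod_self_sum: "x \<in> carrier_vec n \<Longrightarrow> x \<bullet> x = (\<Sum>i<n. (x $ i)\<^sup>2)" for x :: "real vec"
  by (auto simp: scalar_prod_def power2_eq_square atLeast0LessThan)

lemma scalar_prod_self_nonneg: "0 \<le> x \<bullet> x" for x :: "real vec"
  by (simp add: scalar_prod_def sum_nonneg)

lemma scalar_prod_self_pos: "x \<in> carrier_vec n \<Longrightarrow> x \<noteq> 0\<^sub>v n \<Longrightarrow> 0 < x \<bullet> x" for x :: "real vec"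
  using conjugate_square_greater_0_vec[of x n] by simp

lemma quadratic_form_mat_diag:
  fixes x :: "real vec"
  assumes "x \<in> carrier_vec n"
  shows "x \<bullet> (mat_diag n f *\<^sub>v x) = (\<Sum>i<n. f i * (x $ i)\<^sup>2)"
proof -
  have "(mat_diag n f *\<^sub>v x) $ i = f i * x $ i" if "i < n" for i
  proof -
    have "(mat_diag n f *\<^sub>v x) $ i = (\<Sum>j<n. (if i = j then f j else 0) * x $ j)"
      using that assms by (auto simp: mat_diag_def scalar_prod_def atLeast0LessThan intro!: sum.cong)
    also have "\<dots> = (\<Sum>j<n. if i = j then f j * x $ j else 0)" by (intro sum.cong) auto
    finally show ?thesis using that by simp
  qed
  moreover have "dim_vec (mat_diag n f *\<^sub>v x) = n" by (simp add: mat_diag_def)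
  ultimately show ?thesis
    by (auto simp: scalar_prod_def atLeast0LessThan power2_eq_square intro!: sum.cong)
qed

text \<open>These are \<open>i - 1\<close> homogeneous equations in \<open>i\<close> unknowns.
  Completing the first \<open>i - 1\<close> rows of \<open>Y\<close> by a zero row gives a square
  matrix \<open>E\<close> whose transpose kills the last unit vector; so \<open>det E = 0\<close>
  and \<open>E\<close> has a nonzero kernel vector.\<close>

lemma ex_vec_mult_eq_0_upto:
  fixes Y :: "'a :: field mat"
  assumes Y: "Y \<in> carrier_mat n i" and i: "1 \<le> i" "i \<le> n"
  shows "\<exists>z\<in>carrier_vec i. z \<noteq> 0\<^sub>v i \<and> (\<forall>a<i - 1. (Y *\<^sub>v z) $ a = 0)"
proof -
  define E where "E = mat i i (\<lambda>(a, b). if a < i - 1 then Y $$ (a, b) else 0)"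
  have E: "E \<in> carrier_mat i i" by (simp add: E_def)
  have "E\<^sup>T *\<^sub>v unit_vec i (i - 1) = 0\<^sub>v i"
    using i by (intro eq_vecI) (auto simp: E_def)
  then have "det E\<^sup>T = 0"
    using i det_0_iff_vec_prod_zero_field[of "E\<^sup>T" i] E by (auto intro!: exI[of _ "unit_vec i (i - 1)"])
  then have "det E = 0" using det_transpose[OF E] by simp
  then obtain z where z: "z \<in> carrier_vec i" "z \<noteq> 0\<^sub>v i" "E *\<^sub>v z = 0\<^sub>v i"
    using det_0_iff_vec_prod_zero_field[OF E] by auto
  have "(Y *\<^sub>v z) $ a = 0" if a: "a < i - 1" for a
  proof -
    have "row E a = row Y a" using a i Y by (intro eq_vecI) (auto simp: E_def)
    then have "(Y *\<^sub>v z) $ a = (E *\<^sub>v z) $ a" using a i Y E by simp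
    then show ?thesis using a z(3) by simp
  qed
  then show ?thesis using z by auto
qed

text \<open>Courant--Fischer: some nonzero vector in the range of W is orthogonal to the first i - 1
  eigenvectors, since this imposes i - 1 equations on i unknowns.\<close>

lemma eigval_ge_of_rayleigh:
  assumes S: "symmetric_real_mat n S" and W: "W \<in> carrier_mat n i" and i: "1 \<le> i" "i \<le> n"
    and form: "\<And>z. z \<in> carrier_vec i \<Longrightarrow> z \<noteq> 0\<^sub>v i \<Longrightarrow>
      W *\<^sub>v z \<noteq> 0\<^sub>v n \<and> c * ((W *\<^sub>v z) \<bullet> (W *\<^sub>v z)) \<le> (W *\<^sub>v z) \<bullet> (S *\<^sub>v (W *\<^sub>v z))"
  shows "c \<le> eigval i S"
proof -
  have Sc: "S \<in> carrier_mat n n" using S by (auto simp: symmetric_real_mat_def)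
  obtain Q where Q: "Q \<in> orthonormal_cols n n" "Q\<^sup>T * S * Q = mat_diag n (\<lambda>i. eigval (Suc i) S)"
    using symmetric_mat_eigval(1)[OF S] by auto
  then have Qc: "Q \<in> carrier_mat n n" "Q\<^sup>T * Q = 1\<^sub>m n" by (auto simp: orthonormal_cols_def)
  have QQ: "Q * Q\<^sup>T = 1\<^sub>m n" using mat_mult_left_right_inverse[OF _ Qc] Qc by auto
  obtain z where z: "z \<in> carrier_vec i" "z \<noteq> 0\<^sub>v i" "\<And>a. a < i - 1 \<Longrightarrow> (Q\<^sup>T * W *\<^sub>v z) $ a = 0"
    using ex_vec_mult_eq_0_upto[of "Q\<^sup>T * W" n i] Qc W i by auto
  define y where "y = Q\<^sup>T *\<^sub>v (W *\<^sub>v z)"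
  have Wz: "W *\<^sub>v z \<in> carrier_vec n" using W z by auto
  then have y: "y \<in> carrier_vec n" using Qc by (auto simp: y_def)
  have Qy: "W *\<^sub>v z = Q *\<^sub>v y"
    using Qc Wz QQ by (simp add: y_def flip: assoc_mult_mat_vec[of _ n n _ n])
  have y0: "y $ a = 0" if "a < i - 1" for a
    using z(3)[OF that] Qc W z(1) by (simp add: y_def assoc_mult_mat_vec[of _ n n _ i])
  have "c * (y \<bullet> y) \<le> y \<bullet> (mat_diag n (\<lambda>i. eigval (Suc i) S) *\<^sub>v y)"
    using form[OF z(1,2)] unfolding Qy orthonormal_cols_isometry[OF Q(1) y]
      quadratic_form_mult_mat_vec[OF Sc Qc(1) y] Q(2) by simp
  also have "\<dots> = (\<Sum>a<n. eigval (Suc a) S * (y $ a)\<^sup>2)" by (rule quadratic_form_mat_diag[OF y])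
  \<comment> \<open>Coordinates with \<open>a < i - 1\<close> vanish; the others belong to
    eigenvalues of index \<open>Suc a\<close> \<ge> \<open>i\<close>, which are at most
    \<open>eigval i S\<close>.\<close>
  also have "\<dots> \<le> (\<Sum>a<n. eigval i S * (y $ a)\<^sup>2)"
  proof (rule sum_mono)
    fix a assume "a \<in> {..<n}"
    then show "eigval (Suc a) S * (y $ a)\<^sup>2 \<le> eigval i S * (y $ a)\<^sup>2"
      using y0[of a] symmetric_mat_eigval(2)[OF S i(1), of "Suc a"]
      by (cases "a < i - 1") (auto intro!: mult_right_mono)
  qed
  also have "\<dots> = eigval i S * (y \<bullet> y)" by (simp add: scalar_prod_self_sum[OF y] sum_distrib_left)
  finally have "c * (y \<bullet> y) \<le> eigval i S * (y \<bullet> y)" .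
  moreover have "0 < y \<bullet> y"
    using form[OF z(1,2)] scalar_prod_self_pos[OF Wz] unfolding Qy orthonormal_cols_isometry[OF Q(1) y] by simp
  ultimately show ?thesis by simp
qed

lemma ex_orthonormal_cols_eigval:
  assumes S: "symmetric_real_mat n S" and i: "i \<le> n"
  shows "\<exists>W\<in>orthonormal_cols n i. W\<^sup>T * S * W = mat_diag i (\<lambda>a. eigval (Suc a) S)"
proof -
  have Sc: "S \<in> carrier_mat n n" using S by (auto simp: symmetric_real_mat_def)
  obtain Q where Q: "Q \<in> orthonormal_cols n n" "Q\<^sup>T * S * Q = mat_diag n (\<lambda>i. eigval (Suc i) S)"
    using symmetric_mat_eigval(1)[OF S] by auto
  \<comment> \<open>Right multiplication by \<open>J\<close> keeps the first \<open>i\<close>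
    columns of \<open>Q\<close>, the eigenvectors of the \<open>i\<close> largest
    eigenvalues.\<close>
  define J :: "real mat" where "J = mat n i (\<lambda>(a, b). if a = b then 1 else 0)"
  have J: "J \<in> carrier_mat n i" by (simp add: J_def)
  have colJ: "col J b = unit_vec n b" if "b < i" for b
    using that i by (intro eq_vecI) (auto simp: J_def)
  have JJ: "J\<^sup>T * J = 1\<^sub>m i"
    using J i by (intro eq_matI) (auto simp: colJ)
  have "J\<^sup>T * mat_diag n (\<lambda>i. eigval (Suc i) S) * J = mat_diag i (\<lambda>a. eigval (Suc a) S)"
  proof -
    let ?D = "mat_diag n (\<lambda>i. eigval (Suc i) S)"
    have colDJ: "col (?D * J) b = eigval (Suc b) S \<cdot>\<^sub>v unit_vec n b" if "b < i" for b
      unfolding mat_diag_mult_left[OF J] using that i by (intro eq_vecI) (auto simp: J_def)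
    have DJ: "?D * J \<in> carrier_mat n i" using J by (rule mult_carrier_mat[OF mat_diag_dim])
    have "J\<^sup>T * ?D * J = J\<^sup>T * (?D * J)"
      using J by (intro assoc_mult_mat[of _ i n _ n _ i]) auto
    also have "\<dots> = mat_diag i (\<lambda>a. eigval (Suc a) S)"
    proof (rule eq_matI)
      fix a b assume "a < dim_row (mat_diag i (\<lambda>a. eigval (Suc a) S))"
        "b < dim_col (mat_diag i (\<lambda>a. eigval (Suc a) S))"
      then have ab: "a < i" "b < i" by (auto simp: mat_diag_def)
      then have "(J\<^sup>T * (?D * J)) $$ (a, b) = col J a \<bullet> col (?D * J) b"
        using J DJ by (subst index_mult_mat) auto
      then show "(J\<^sup>T * (?D * J)) $$ (a, b) = mat_diag i (\<lambda>a. eigval (Suc a) S) $$ (a, b)"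
        unfolding colJ[OF ab(1)] colDJ[OF ab(2)] using ab i by (simp add: mat_diag_def)
    qed (use J DJ in \<open>auto simp: mat_diag_def\<close>)
    finally show ?thesis .
  qed
  then have "(Q * J)\<^sup>T * S * (Q * J) = mat_diag i (\<lambda>a. eigval (Suc a) S)"
    using congruence_mult[OF Sc _ J, of Q] Q by (auto simp: orthonormal_cols_def)
  moreover have "Q * J \<in> orthonormal_cols n i"
    using Q(1) J JJ by (intro orthonormal_cols_mult) (auto simp: orthonormal_cols_def)
  ultimately show ?thesis by blast
qed

text \<open>\<open>T\<close> carries the span of the top \<open>i\<close> eigenvectors of
  \<open>N\<close>, where the form of \<open>N\<close> is at least \<open>eigval i N\<close> times
  the squared length, to a test space for \<open>S\<close>. It is applied along V for interlacing,
  along U for the upper bound and along U^T V for the lower bound.\<close>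

lemma eigval_le_of_form_le:
  assumes S: "symmetric_real_mat n S" and N: "symmetric_real_mat m N" and T: "T \<in> carrier_mat n m"
    and i: "1 \<le> i" "i \<le> m" "i \<le> n"
    and form: "\<And>y. y \<in> carrier_vec m \<Longrightarrow> y \<noteq> 0\<^sub>v m \<Longrightarrow> eigval i N * (y \<bullet> y) \<le> y \<bullet> (N *\<^sub>v y) \<Longrightarrow>
      T *\<^sub>v y \<noteq> 0\<^sub>v n \<and> c * ((T *\<^sub>v y) \<bullet> (T *\<^sub>v y)) \<le> (T *\<^sub>v y) \<bullet> (S *\<^sub>v (T *\<^sub>v y))"
  shows "c \<le> eigval i S"
proof -
  have Nc: "N \<in> carrier_mat m m" using N by (auto simp: symmetric_real_mat_def)
  obtain W where W: "W \<in> orthonormal_cols m i" "W\<^sup>T * N * W = mat_diag i (\<lambda>a. eigval (Suc a) N)"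
    using ex_orthonormal_cols_eigval[OF N i(2)] by auto
  have Wc: "W \<in> carrier_mat m i" using W by (auto simp: orthonormal_cols_def)
  show ?thesis
  proof (rule eigval_ge_of_rayleigh[OF S _ i(1,3)])
    show "T * W \<in> carrier_mat n i" using T Wc by simp
    fix z :: "real vec" assume z: "z \<in> carrier_vec i" "z \<noteq> 0\<^sub>v i"
    have "eigval i N * (z \<bullet> z) \<le> (\<Sum>a<i. eigval (Suc a) N * (z $ a)\<^sup>2)"
      unfolding scalar_prod_self_sum[OF z(1)] sum_distrib_left
      using i symmetric_mat_eigval(2)[OF N] by (intro sum_mono mult_right_mono) auto
    then have "eigval i N * ((W *\<^sub>v z) \<bullet> (W *\<^sub>v z)) \<le> (W *\<^sub>v z) \<bullet> (N *\<^sub>v (W *\<^sub>v z))"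
      unfolding orthonormal_cols_isometry[OF W(1) z(1)] quadratic_form_mult_mat_vec[OF Nc Wc z(1)] W(2)
        quadratic_form_mat_diag[OF z(1)] .
    moreover have "W *\<^sub>v z \<noteq> 0\<^sub>v m"
      using scalar_prod_self_pos[OF z] orthonormal_cols_isometry[OF W(1) z(1)] by auto
    moreover have "T * W *\<^sub>v z = T *\<^sub>v (W *\<^sub>v z)" using T Wc z(1) by simp
    ultimately show "T * W *\<^sub>v z \<noteq> 0\<^sub>v n \<and> c * ((T * W *\<^sub>v z) \<bullet> (T * W *\<^sub>v z))
        \<le> (T * W *\<^sub>v z) \<bullet> (S *\<^sub>v (T * W *\<^sub>v z))"
      using form[of "W *\<^sub>v z"] Wc z(1) by simp
  qed
qed

section \<open>Traces as sums of eigenvalues\<close>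

lemma mat_trace_mult_comm:
  assumes "A \<in> carrier_mat n m" "B \<in> carrier_mat m n"
  shows "mat_trace (A * B) = mat_trace (B * A)"
proof -
  have "mat_trace (A * B) = (\<Sum>i<n. \<Sum>j<m. A $$ (i, j) * B $$ (j, i))"
    using assms by (auto simp: mat_trace_def scalar_prod_def atLeast0LessThan intro!: sum.cong)
  also have "\<dots> = (\<Sum>j<m. \<Sum>i<n. B $$ (j, i) * A $$ (i, j))"
    by (subst sum.swap) (simp add: mult.commute)
  also have "\<dots> = mat_trace (B * A)"
    using assms by (auto simp: mat_trace_def scalar_prod_def atLeast0LessThan intro!: sum.cong)
  finally show ?thesis .
qed

lemma mat_trace_mat_diag: "mat_trace (mat_diag n f) = (\<Sum>i<n. f i)"
  by (simp add: mat_trace_def mat_diag_def)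

lemma mat_trace_eq_sum_eigval:
  assumes S: "symmetric_real_mat n S"
  shows "mat_trace S = (\<Sum>i<n. eigval (Suc i) S)"
proof -
  have Sc: "S \<in> carrier_mat n n" using S by (auto simp: symmetric_real_mat_def)
  obtain Q where Q: "Q \<in> orthonormal_cols n n" "Q\<^sup>T * S * Q = mat_diag n (\<lambda>i. eigval (Suc i) S)"
    using symmetric_mat_eigval(1)[OF S] by auto
  then have Qc: "Q \<in> carrier_mat n n" "Q\<^sup>T * Q = 1\<^sub>m n" by (auto simp: orthonormal_cols_def)
  have QQ: "Q * Q\<^sup>T = 1\<^sub>m n" using mat_mult_left_right_inverse[OF _ Qc] Qc by auto
  have "(\<Sum>i<n. eigval (Suc i) S) = mat_trace (Q\<^sup>T * S * Q)" by (simp add: Q(2) mat_trace_mat_diag)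
  also have "\<dots> = mat_trace (Q * (Q\<^sup>T * S))"
    using Qc Sc by (intro mat_trace_mult_comm[of _ n n]) auto
  also have "Q * (Q\<^sup>T * S) = S"
    using Qc Sc QQ by (simp flip: assoc_mult_mat[of _ n n _ n _ n])
  finally show ?thesis by simp
qed

section \<open>Norm estimates and positive definite forms\<close>

lemma scalar_prod_Cauchy_Schwarz:
  fixes x y :: "real vec"
  assumes x: "x \<in> carrier_vec n" and y: "y \<in> carrier_vec n"
  shows "(x \<bullet> y)\<^sup>2 \<le> (x \<bullet> x) * (y \<bullet> y)"
proof (cases "y = 0\<^sub>v n")
  case False
  let ?a = "x \<bullet> x" and ?b = "x \<bullet> y" and ?c = "y \<bullet> y"
  have c: "0 < ?c" using scalar_prod_self_pos[OF y False] .
  \<comment> \<open>The component of \<open>x\<close> orthogonal to \<open>y\<close>, scaled by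
    \<open>?c\<close> to avoid a division.\<close>
  let ?v = "?c \<cdot>\<^sub>v x - ?b \<cdot>\<^sub>v y"
  have "?v \<bullet> ?v = ?c * (?c * ?a - ?b\<^sup>2)"
    using x y by (simp add: minus_scalar_prod_distrib[of _ n] scalar_prod_minus_distrib[of _ n]
        comm_scalar_prod[of y n x] power2_eq_square algebra_simps)
  then have "0 \<le> ?c * (?c * ?a - ?b\<^sup>2)" using scalar_prod_self_nonneg[of ?v] by simp
  then show ?thesis using c by (simp add: zero_le_mult_iff mult.commute)
qed (use x in simp)

lemma euclid_norm_nonneg [simp]: "0 \<le> euclid_norm x"
  by (simp add: euclid_norm_def scalar_prod_self_nonneg)

lemma euclid_norm_power2: "(euclid_norm x)\<^sup>2 = x \<bullet> x"
  by (simp add: euclid_norm_def scalar_prod_self_nonneg)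

lemma abs_scalar_prod_le:
  assumes "x \<in> carrier_vec n" "y \<in> carrier_vec n"
  shows "\<bar>x \<bullet> y\<bar> \<le> euclid_norm x * euclid_norm y"
  using real_sqrt_le_mono[OF scalar_prod_Cauchy_Schwarz[OF assms]]
  by (simp add: euclid_norm_def real_sqrt_mult)

lemma euclid_norm_smult: "euclid_norm (c \<cdot>\<^sub>v x) = \<bar>c\<bar> * euclid_norm x"
proof -
  have "(c \<cdot>\<^sub>v x) \<bullet> (c \<cdot>\<^sub>v x) = c\<^sup>2 * (x \<bullet> x)"
    by (simp add: power2_eq_square)
  then show ?thesis by (simp add: euclid_norm_def real_sqrt_mult)
qed

text \<open>\<open>spectral_norm\<close> is a supremum of reals, which dominates the members of its
  set only once that set is known to be bounded. Cauchy-Schwarz on every row gives the Frobenius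
  norm as a bound.\<close>

lemma bdd_above_mult_unit_ball:
  "bdd_above ((\<lambda>x. euclid_norm (A *\<^sub>v x)) ` {x \<in> carrier_vec (dim_col A). euclid_norm x \<le> 1})"
proof (rule bdd_aboveI2)
  fix x assume "x \<in> {x \<in> carrier_vec (dim_col A). euclid_norm x \<le> 1}"
  then have x: "x \<in> carrier_vec (dim_col A)" and x1: "x \<bullet> x \<le> 1"
    by (auto simp: euclid_norm_def)
  have "(A *\<^sub>v x) \<bullet> (A *\<^sub>v x) = (\<Sum>i<dim_row A. (row A i \<bullet> x)\<^sup>2)"
    by (subst scalar_prod_self_sum[of _ "dim_row A"]) (auto intro!: carrier_vecI)
  also have "\<dots> \<le> (\<Sum>i<dim_row A. row A i \<bullet> row A i)"
  proof (rule sum_mono)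
    fix i
    have "(row A i \<bullet> x)\<^sup>2 \<le> (row A i \<bullet> row A i) * (x \<bullet> x)"
      using x by (intro scalar_prod_Cauchy_Schwarz[of _ "dim_col A"]) auto
    also have "\<dots> \<le> row A i \<bullet> row A i"
      by (rule mult_left_le[OF x1 scalar_prod_self_nonneg])
    finally show "(row A i \<bullet> x)\<^sup>2 \<le> row A i \<bullet> row A i" .
  qed
  finally show "euclid_norm (A *\<^sub>v x) \<le> sqrt (\<Sum>i<dim_row A. row A i \<bullet> row A i)"
    by (simp add: euclid_norm_def)
qed

lemma euclid_norm_mult_mat_vec_le:
  assumes A: "A \<in> carrier_mat n m" and x: "x \<in> carrier_vec m"
  shows "euclid_norm (A *\<^sub>v x) \<le> spectral_norm A * euclid_norm x"
proof (cases "x = 0\<^sub>v m")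
  case True
  have "A *\<^sub>v 0\<^sub>v m = 0\<^sub>v n" using A by (intro eq_vecI) auto
  then show ?thesis by (simp add: True euclid_norm_def)
next
  case False
  let ?c = "euclid_norm x"
  have c: "0 < ?c" using scalar_prod_self_pos[OF x False] by (simp add: euclid_norm_def)
  have "euclid_norm (A *\<^sub>v ((1 / ?c) \<cdot>\<^sub>v x)) \<le> spectral_norm A"
    unfolding spectral_norm_def using A x c
    by (intro cSUP_upper bdd_above_mult_unit_ball) (auto simp: euclid_norm_smult)
  then show ?thesis using A x c by (simp add: mult_mat_vec[of _ n m] euclid_norm_smult divide_simps mult.commute)
qed

lemma spectral_norm_nonneg: "0 \<le> spectral_norm A"
proof -
  have "euclid_norm (A *\<^sub>v 0\<^sub>v (dim_col A)) \<le> spectral_norm A"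
    unfolding spectral_norm_def
    by (intro cSUP_upper bdd_above_mult_unit_ball) (auto simp: euclid_norm_def)
  then show ?thesis using euclid_norm_nonneg order_trans by blast
qed

lemma abs_bilinear_form_le:
  assumes A: "A \<in> carrier_mat n n" and x: "x \<in> carrier_vec n" and y: "y \<in> carrier_vec n"
  shows "\<bar>x \<bullet> (A *\<^sub>v y)\<bar> \<le> spectral_norm A * euclid_norm x * euclid_norm y"
proof -
  have "\<bar>x \<bullet> (A *\<^sub>v y)\<bar> \<le> euclid_norm x * euclid_norm (A *\<^sub>v y)"
    using A x y by (intro abs_scalar_prod_le[of _ n]) auto
  also have "\<dots> \<le> euclid_norm x * (spectral_norm A * euclid_norm y)"
    by (intro mult_left_mono euclid_norm_mult_mat_vec_le[OF A y]) simp
  finally show ?thesis by (simp add: mult_ac)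
qed

text \<open>The constant is the smallest eigenvalue \<open>eigval n B\<close>. It is positive as the
  value of the form at the last column of \<open>Q\<close>, which exists because
  \<open>1 \<le> n\<close>.\<close>

lemma pos_def_mat_form_ge:
  assumes B: "pos_def_mat n B" and n: "1 \<le> n"
  shows "\<exists>b>0. \<forall>x\<in>carrier_vec n. b * (x \<bullet> x) \<le> x \<bullet> (B *\<^sub>v x)"
proof (intro exI conjI ballI)
  have S: "symmetric_real_mat n B" using B by (simp add: pos_def_mat_def)
  have Bc: "B \<in> carrier_mat n n" using S by (auto simp: symmetric_real_mat_def)
  obtain Q where Q: "Q \<in> orthonormal_cols n n" "Q\<^sup>T * B * Q = mat_diag n (\<lambda>i. eigval (Suc i) B)"
    using symmetric_mat_eigval(1)[OF S] by auto
  then have Qc: "Q \<in> carrier_mat n n" "Q\<^sup>T * Q = 1\<^sub>m n" by (auto simp: orthonormal_cols_def)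
  have QQ: "Q * Q\<^sup>T = 1\<^sub>m n" using mat_mult_left_right_inverse[OF _ Qc] Qc by auto
  have form: "(Q *\<^sub>v y) \<bullet> (B *\<^sub>v (Q *\<^sub>v y)) = (\<Sum>i<n. eigval (Suc i) B * (y $ i)\<^sup>2)"
    if "y \<in> carrier_vec n" for y
    unfolding quadratic_form_mult_mat_vec[OF Bc Qc(1) that] Q(2) quadratic_form_mat_diag[OF that] ..
  show "0 < eigval n B"
  proof -
    let ?e = "unit_vec n (n - 1) :: real vec"
    have "?e \<bullet> ?e = 1" using n by simp
    then have "Q *\<^sub>v ?e \<noteq> 0\<^sub>v n" using orthonormal_cols_isometry[OF Q(1), of ?e] by auto
    then have "0 < (Q *\<^sub>v ?e) \<bullet> (B *\<^sub>v (Q *\<^sub>v ?e))" using B Qc by (auto simp: pos_def_mat_def)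
    also have "\<dots> = (\<Sum>i<n. if i = n - 1 then eigval (Suc i) B else 0)"
      unfolding form[OF unit_vec_carrier] by (rule sum.cong) auto
    also have "\<dots> = eigval n B" using n by simp
    finally show ?thesis .
  qed
  fix x :: "real vec" assume x: "x \<in> carrier_vec n"
  define y where "y = Q\<^sup>T *\<^sub>v x"
  have y: "y \<in> carrier_vec n" using Qc x by (simp add: y_def)
  have Qy: "x = Q *\<^sub>v y"
    using Qc x QQ by (simp add: y_def flip: assoc_mult_mat_vec[of _ n n _ n])
  have "eigval n B * (y \<bullet> y) \<le> (\<Sum>i<n. eigval (Suc i) B * (y $ i)\<^sup>2)"
    unfolding scalar_prod_self_sum[OF y] sum_distrib_left
    using symmetric_mat_eigval(2)[OF S] by (intro sum_mono mult_right_mono) auto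
  then show "eigval n B * (x \<bullet> x) \<le> x \<bullet> (B *\<^sub>v x)"
    unfolding Qy form[OF y] orthonormal_cols_isometry[OF Q(1) y] .
qed

section \<open>Orthogonal projection and perturbation of Rayleigh quotients\<close>

lemma mem_col_space_iff:
  fixes y :: "'a :: field vec"
  assumes "A \<in> carrier_mat n m"
  shows "y \<in> vec_space.col_space n A \<longleftrightarrow> (\<exists>x\<in>carrier_vec m. A *\<^sub>v x = y)"
  unfolding vec_space.col_space_eq[OF assms] using assms by auto

text \<open>Translates the sine, defined through a basis \<open>U'\<close> of the complement, into
  the distance of \<open>x\<close> from its projection \<open>u\<close>. The residual lies in the
  complement, so it is \<open>U'\<close> y for some y; as the transpose of \<open>U'\<close>
  annihilates \<open>u\<close>, y is the transpose of \<open>U'\<close> applied to \<open>x\<close>,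
  and \<open>U'\<close> preserves lengths.\<close>

lemma orthogonal_projection_residual:
  fixes x :: "real vec"
  assumes U: "U \<in> orthonormal_cols n j" and U': "U' \<in> orthonormal_cols n m"
    and compl: "vec_space.col_space n U' = orth_complement n (vec_space.col_space n U)"
    and x: "x \<in> carrier_vec n"
  defines "u \<equiv> U *\<^sub>v (U\<^sup>T *\<^sub>v x)"
  shows "euclid_norm (x - u) = euclid_norm (U'\<^sup>T *\<^sub>v x)"
    and "x \<bullet> x = u \<bullet> u + (x - u) \<bullet> (x - u)"
proof -
  have Uc: "U \<in> carrier_mat n j" "U\<^sup>T * U = 1\<^sub>m j" and U'c: "U' \<in> carrier_mat n m" "U'\<^sup>T * U' = 1\<^sub>m m"
    using U U' by (auto simp: orthonormal_cols_def)
  define t where "t = U\<^sup>T *\<^sub>v x"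
  have t: "t \<in> carrier_vec j" using Uc x by (simp add: t_def)
  have u: "u = U *\<^sub>v t" "u \<in> carrier_vec n" using Uc t by (auto simp: u_def t_def)
  define w where "w = x - u"
  have w: "w \<in> carrier_vec n" using x u by (simp add: w_def)
  have "U\<^sup>T *\<^sub>v u = t" unfolding u(1) using Uc t by (simp flip: assoc_mult_mat_vec[of _ j n _ j])
  then have Uw: "U\<^sup>T *\<^sub>v w = 0\<^sub>v j"
    unfolding w_def using Uc x u(2) t
    by (simp add: mult_minus_distrib_mat_vec[of _ j n] flip: t_def)
  have Ustar: "(U *\<^sub>v a) \<bullet> w = 0" if "a \<in> carrier_vec j" for a
    using that Uc w by (simp add: scalar_prod_mult_mat_vec_left[of U n j] Uw)
  then have "w \<in> orth_complement n (vec_space.col_space n U)"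
    using w by (auto simp: orth_complement_def mem_col_space_iff[OF Uc(1)])
  then obtain y where y: "y \<in> carrier_vec m" "w = U' *\<^sub>v y"
    unfolding compl[symmetric] mem_col_space_iff[OF U'c(1)] by auto
  have "U'\<^sup>T *\<^sub>v u = 0\<^sub>v m"
  proof (rule eq_vecI)
    fix i assume "i < dim_vec (0\<^sub>v m :: real vec)"
    then have i: "i < m" by simp
    have "U' *\<^sub>v unit_vec m i \<in> orth_complement n (vec_space.col_space n U)"
      unfolding compl[symmetric] mem_col_space_iff[OF U'c(1)] by auto
    moreover have "u \<bullet> v = 0" if "v \<in> orth_complement n (vec_space.col_space n U)" for v
    proof -
      have "u \<in> vec_space.col_space n U" using t by (auto simp: mem_col_space_iff[OF Uc(1)] u(1))
      then show ?thesis using that by (simp add: orth_complement_def)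
    qed
    ultimately have "u \<bullet> (U' *\<^sub>v unit_vec m i) = 0" by blast
    then have "unit_vec m i \<bullet> (U'\<^sup>T *\<^sub>v u) = 0"
      using U'c u(2) comm_scalar_prod[of u n "U' *\<^sub>v unit_vec m i"]
      by (simp add: scalar_prod_mult_mat_vec_left[of U' n m])
    then show "(U'\<^sup>T *\<^sub>v u) $ i = 0\<^sub>v m $ i"
      using i U'c u(2) by (simp add: scalar_prod_left_unit[of _ m])
  qed (use U'c in simp)
  moreover have "U'\<^sup>T *\<^sub>v w = y"
    unfolding y(2) using U'c y by (simp flip: assoc_mult_mat_vec[of _ m n _ m])
  moreover have xuw: "x = u + w" using x u(2) unfolding w_def by (intro eq_vecI) auto
  ultimately have "U'\<^sup>T *\<^sub>v x = y"
    using U'c u(2) w y(1) by (simp add: mult_add_distrib_mat_vec[of _ m n])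
  then show "euclid_norm (x - u) = euclid_norm (U'\<^sup>T *\<^sub>v x)"
    using orthonormal_cols_isometry[OF U' y(1)] by (simp add: euclid_norm_def y(2) flip: w_def)
  have "u \<bullet> w = 0" unfolding u(1) using Ustar[OF t] .
  then show "x \<bullet> x = u \<bullet> u + (x - u) \<bullet> (x - u)"
    unfolding w_def[symmetric] using xuw u(2) w comm_scalar_prod[OF w u(2)]
    by (simp add: add_scalar_prod_distrib[of _ n] scalar_prod_add_distrib[of _ n])
qed

text \<open>With w = x - u, the two cross terms cost 2 |M| s |x|^2, and passing from c |x|^2 to c
  |u|^2 costs at most |c| s |x|^2 for either sign of c. Since s \<le> 1/2 gives |x|^2 \<le> 2 |u|^2,
  measuring the error in |u|^2 doubles it to (4 |M| + 2 |c|) s.\<close>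

lemma rayleigh_perturbation:
  assumes M: "symmetric_real_mat n M" and x: "x \<in> carrier_vec n" and u: "u \<in> carrier_vec n"
    and pyth: "x \<bullet> x = u \<bullet> u + (x - u) \<bullet> (x - u)"
    and near: "euclid_norm (x - u) \<le> s * euclid_norm x" and s: "0 \<le> s" "s \<le> 1 / 2"
    and form: "c * (x \<bullet> x) \<le> x \<bullet> (M *\<^sub>v x)"
  shows "(c - (4 * spectral_norm M + 2 * \<bar>c\<bar>) * s) * (u \<bullet> u) \<le> u \<bullet> (M *\<^sub>v u)"
    and "x \<bullet> x \<le> 2 * (u \<bullet> u)"
proof -
  have Mc: "M \<in> carrier_mat n n" using M by (simp add: symmetric_real_mat_def)
  define w where "w = x - u"
  have w: "w \<in> carrier_vec n" and xuw: "x = u + w"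
    using x u unfolding w_def by (auto intro!: eq_vecI)
  let ?m = "spectral_norm M"
  let ?X = "x \<bullet> x"
  have X: "0 \<le> ?X" by (rule scalar_prod_self_nonneg)
  have w2: "w \<bullet> w \<le> s\<^sup>2 * ?X"
    using power_mono[OF near, of 2] by (simp add: power_mult_distrib euclid_norm_power2 flip: w_def)
  \<comment> \<open>Absorbing one factor \<open>s\<close> makes the squared length of
    \<open>w\<close> an error linear in \<open>s\<close>, like the others.\<close>
  have ss: "s\<^sup>2 \<le> s * (1 / 2)" unfolding power2_eq_square using s by (intro mult_left_mono) auto
  have w2': "w \<bullet> w \<le> s * ?X"
    using w2 mult_right_mono[OF _ X, of "s\<^sup>2" s] ss s by linarith
  have "s\<^sup>2 * ?X \<le> (1 / 2) * ?X" using ss s by (intro mult_right_mono X) auto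
  then show X2: "?X \<le> 2 * (u \<bullet> u)" using w2 pyth by (simp flip: w_def)
  have ux: "euclid_norm u \<le> euclid_norm x"
    using pyth scalar_prod_self_nonneg[of "x - u"] by (simp add: euclid_norm_def)
  have nw: "euclid_norm w * euclid_norm x \<le> s * ?X"
    using mult_right_mono[OF near euclid_norm_nonneg[of x]]
    by (simp add: euclid_norm_power2[symmetric] power2_eq_square mult.assoc w_def)
  \<comment> \<open>Pairing \<open>w\<close> with the whole of \<open>x\<close> absorbs the term
    quadratic in \<open>w\<close>, so only two cross terms remain.\<close>
  have "x \<bullet> (M *\<^sub>v x) = u \<bullet> (M *\<^sub>v u) + u \<bullet> (M *\<^sub>v w) + w \<bullet> (M *\<^sub>v x)"
    using Mc u w unfolding xuw
    by (simp add: mult_add_distrib_mat_vec[of _ n n] add_scalar_prod_distrib[of _ n] scalar_prod_add_distrib[of _ n])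
  moreover have "u \<bullet> (M *\<^sub>v w) \<le> ?m * (s * ?X)"
  proof -
    have "u \<bullet> (M *\<^sub>v w) \<le> ?m * euclid_norm u * euclid_norm w"
      using abs_bilinear_form_le[OF Mc u w] by linarith
    also have "\<dots> \<le> ?m * (euclid_norm w * euclid_norm x)"
      using ux by (simp add: mult.assoc mult.commute[of "euclid_norm u"] mult_left_mono spectral_norm_nonneg)
    also have "\<dots> \<le> ?m * (s * ?X)" by (intro mult_left_mono nw spectral_norm_nonneg)
    finally show ?thesis .
  qed
  moreover have "w \<bullet> (M *\<^sub>v x) \<le> ?m * (s * ?X)"
  proof -
    have "w \<bullet> (M *\<^sub>v x) \<le> ?m * (euclid_norm w * euclid_norm x)"
      using abs_bilinear_form_le[OF Mc w x] by (simp add: mult.assoc)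
    also have "\<dots> \<le> ?m * (s * ?X)" by (intro mult_left_mono nw spectral_norm_nonneg)
    finally show ?thesis .
  qed
  ultimately have "u \<bullet> (M *\<^sub>v u) \<ge> c * ?X - 2 * ?m * s * ?X" using form by (simp add: mult.assoc)
  moreover have "c * ?X = c * (u \<bullet> u) + c * (w \<bullet> w)" using pyth by (simp add: w_def algebra_simps)
  moreover have "c * (w \<bullet> w) \<ge> - (\<bar>c\<bar> * (s * ?X))"
  proof -
    have "- (c * (w \<bullet> w)) \<le> \<bar>c\<bar> * (w \<bullet> w)"
      using mult_right_mono[OF _ scalar_prod_self_nonneg[of w], of "- c" "\<bar>c\<bar>"] by simp
    also have "\<dots> \<le> \<bar>c\<bar> * (s * ?X)" by (intro mult_left_mono w2') simp
    finally show ?thesis by linarith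
  qed
  ultimately have "u \<bullet> (M *\<^sub>v u) \<ge> c * (u \<bullet> u) - (2 * ?m + \<bar>c\<bar>) * s * ?X"
    by (simp add: algebra_simps)
  moreover have "(2 * ?m + \<bar>c\<bar>) * s * ?X \<le> (2 * ?m + \<bar>c\<bar>) * s * (2 * (u \<bullet> u))"
    using X2 s spectral_norm_nonneg[of M] by (intro mult_left_mono) auto
  ultimately show "(c - (4 * ?m + 2 * \<bar>c\<bar>) * s) * (u \<bullet> u) \<le> u \<bullet> (M *\<^sub>v u)"
    by (simp add: algebra_simps)
qed

section \<open>The pencil A - r B and the trace ratio\<close>

lemma symmetric_real_mat_congruence:
  "symmetric_real_mat n S \<Longrightarrow> V \<in> carrier_mat n m \<Longrightarrow> symmetric_real_mat m (V\<^sup>T * S * V)"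
  using symmetric_congruence unfolding symmetric_real_mat_def by blast

lemma symmetric_real_mat_pencil:
  assumes "symmetric_real_mat n A" "symmetric_real_mat n B"
  shows "symmetric_real_mat n (A - r \<cdot>\<^sub>m B)"
proof -
  have c: "A \<in> carrier_mat n n" "B \<in> carrier_mat n n" and t: "A\<^sup>T = A" "B\<^sup>T = B"
    using assms by (auto simp: symmetric_real_mat_def)
  have "(A - r \<cdot>\<^sub>m B)\<^sup>T = A\<^sup>T - r \<cdot>\<^sub>m B\<^sup>T"
    using c by (intro eq_matI) auto
  moreover have "A - r \<cdot>\<^sub>m B \<in> carrier_mat n n" using c by (intro minus_carrier_mat smult_carrier_mat)
  ultimately show ?thesis using t by (simp add: symmetric_real_mat_def)
qed

lemma congruence_pencil:
  fixes A B :: "'a :: comm_ring_1 mat"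
  assumes "A \<in> carrier_mat n n" "B \<in> carrier_mat n n" "V \<in> carrier_mat n m"
  shows "V\<^sup>T * (A - r \<cdot>\<^sub>m B) * V = V\<^sup>T * A * V - r \<cdot>\<^sub>m (V\<^sup>T * B * V)"
proof -
  have "V\<^sup>T * (A - r \<cdot>\<^sub>m B) = V\<^sup>T * A - r \<cdot>\<^sub>m (V\<^sup>T * B)"
    using assms by (simp add: mult_minus_distrib_mat[of _ m n _ n] mult_smult_distrib[of _ m n _ n])
  then show ?thesis
    using assms by (simp add: minus_mult_distrib_mat[of _ m n _ _ m] mult_smult_assoc_mat[of _ m n _ m])
qed

lemma mat_trace_congruence_pencil:
  assumes "A \<in> carrier_mat n n" "B \<in> carrier_mat n n" "V \<in> carrier_mat n m"
  shows "mat_trace (V\<^sup>T * (A - r \<cdot>\<^sub>m B) * V) = mat_trace (V\<^sup>T * A * V) - r * mat_trace (V\<^sup>T * B * V)"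
  unfolding congruence_pencil[OF assms] using assms(2,3)
  by (simp add: mat_trace_def sum_subtractf sum_distrib_left)

lemma pencil_form:
  fixes A B :: "'a :: comm_ring_1 mat"
  assumes "A \<in> carrier_mat n n" "B \<in> carrier_mat n n" "x \<in> carrier_vec n"
  shows "x \<bullet> ((A - r \<cdot>\<^sub>m B) *\<^sub>v x) = x \<bullet> (A *\<^sub>v x) - r * (x \<bullet> (B *\<^sub>v x))"
proof -
  have "(A - r \<cdot>\<^sub>m B) *\<^sub>v x = A *\<^sub>v x - r \<cdot>\<^sub>v (B *\<^sub>v x)"
    using assms by (intro eq_vecI) (auto simp: minus_mult_distrib_mat_vec[of _ n n])
  then show ?thesis using assms by (simp add: scalar_prod_minus_distrib[of _ n])
qed

text \<open>The diagonal entries are the values of the form of \<open>B\<close> at the columns of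
  \<open>V\<close>, all positive, and \<open>1 \<le> k\<close> makes the sum nonempty. This allows
  the denominator of the trace ratio to be cleared.\<close>

lemma mat_trace_congruence_pos:
  assumes B: "pos_def_mat n B" and V: "V \<in> orthonormal_cols n k" and k: "1 \<le> k"
  shows "0 < mat_trace (V\<^sup>T * B * V)"
proof -
  have Bc: "B \<in> carrier_mat n n" and Vc: "V \<in> carrier_mat n k"
    using B V by (auto simp: pos_def_mat_def symmetric_real_mat_def orthonormal_cols_def)
  have "0 < (V\<^sup>T * B * V) $$ (i, i)" if i: "i < k" for i
  proof -
    have "unit_vec k i \<bullet> unit_vec k i = (1 :: real)" using i by simp
    then have "V *\<^sub>v unit_vec k i \<noteq> 0\<^sub>v n" using orthonormal_cols_isometry[OF V, of "unit_vec k i"] by auto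
    then have "0 < (V *\<^sub>v unit_vec k i) \<bullet> (B *\<^sub>v (V *\<^sub>v unit_vec k i))"
      using B Vc by (auto simp: pos_def_mat_def)
    also have "\<dots> = unit_vec k i \<bullet> ((V\<^sup>T * B * V) *\<^sub>v unit_vec k i)"
      by (rule quadratic_form_mult_mat_vec[OF Bc Vc]) simp
    also have "\<dots> = ((V\<^sup>T * B * V) *\<^sub>v unit_vec k i) $ i"
      using i Vc by (intro scalar_prod_left_unit) (auto intro!: carrier_vecI)
    also have "\<dots> = row (V\<^sup>T * B * V) i \<bullet> unit_vec k i" using i Vc by (intro index_mult_mat_vec) simp
    also have "\<dots> = row (V\<^sup>T * B * V) i $ i" by (rule scalar_prod_right_unit[OF i])
    also have "\<dots> = (V\<^sup>T * B * V) $$ (i, i)" using i Vc by (intro index_row) auto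
    finally show ?thesis .
  qed
  then show ?thesis unfolding mat_trace_def using k Vc by (intro sum_pos) (auto simp: lessThan_empty_iff)
qed

text \<open>Clearing the positive denominator turns the ratio inequality into a sign condition on
  the trace of the pencil (Dinkelbach's parametrization). \<open>F\<close> stays general to cover
  both the full and the projected feasible set.\<close>

lemma solves_trace_ratio_mat_trace:
  assumes A: "A \<in> carrier_mat n n" and B: "pos_def_mat n B" and k: "1 \<le> k"
    and F: "F \<subseteq> orthonormal_cols n k" and sol: "solves_trace_ratio A B F V r"
  shows "W \<in> F \<Longrightarrow> mat_trace (W\<^sup>T * (A - r \<cdot>\<^sub>m B) * W) \<le> 0"
    and "mat_trace (V\<^sup>T * (A - r \<cdot>\<^sub>m B) * V) = 0"
proof -
  have Bc: "B \<in> carrier_mat n n" using B by (simp add: pos_def_mat_def symmetric_real_mat_def)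
  have carr: "W \<in> carrier_mat n k" if "W \<in> F" for W using F that by (auto simp: orthonormal_cols_def)
  have pos: "0 < mat_trace (W\<^sup>T * B * W)" if "W \<in> F" for W
    using mat_trace_congruence_pos[OF B _ k] F that by auto
  have V: "V \<in> F" and r: "r = trace_ratio A B V" and max: "\<And>W. W \<in> F \<Longrightarrow> trace_ratio A B W \<le> r"
    using sol by (auto simp: solves_trace_ratio_def is_arg_max_def not_less)
  show "mat_trace (W\<^sup>T * (A - r \<cdot>\<^sub>m B) * W) \<le> 0" if W: "W \<in> F"
    using max[OF W] pos[OF W] mat_trace_congruence_pencil[OF A Bc carr[OF W]]
    by (simp add: trace_ratio_def divide_simps mult.commute)
  show "mat_trace (V\<^sup>T * (A - r \<cdot>\<^sub>m B) * V) = 0"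
    using pos[OF V] mat_trace_congruence_pencil[OF A Bc carr[OF V]]
    by (simp add: r trace_ratio_def)
qed

text \<open>The attainment half of Ky Fan's maximum principle: a frame of top eigenvectors, against
  which maximality is tested.\<close>

lemma ex_mat_trace_eq_sum_eigval:
  assumes "symmetric_real_mat n S" "k \<le> n"
  shows "\<exists>W\<in>orthonormal_cols n k. mat_trace (W\<^sup>T * S * W) = (\<Sum>i<k. eigval (Suc i) S)"
  using ex_orthonormal_cols_eigval[OF assms] by (metis mat_trace_mat_diag)

text \<open>One half of Cauchy interlacing: \<open>V\<close> preserves lengths and carries the form
  of the compression to that of \<open>S\<close>.\<close>

lemma eigval_congruence_le:
  assumes S: "symmetric_real_mat n S" and V: "V \<in> orthonormal_cols n m" and i: "1 \<le> i" "i \<le> m" "i \<le> n"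
  shows "eigval i (V\<^sup>T * S * V) \<le> eigval i S"
proof -
  have Sc: "S \<in> carrier_mat n n" and Vc: "V \<in> carrier_mat n m"
    using S V by (auto simp: symmetric_real_mat_def orthonormal_cols_def)
  show ?thesis
  proof (rule eigval_le_of_form_le[OF S symmetric_real_mat_congruence[OF S Vc] Vc i])
    fix y :: "real vec" assume y: "y \<in> carrier_vec m" "y \<noteq> 0\<^sub>v m"
      and le: "eigval i (V\<^sup>T * S * V) * (y \<bullet> y) \<le> y \<bullet> ((V\<^sup>T * S * V) *\<^sub>v y)"
    have "V *\<^sub>v y \<noteq> 0\<^sub>v n"
      using scalar_prod_self_pos[OF y] orthonormal_cols_isometry[OF V y(1)] by auto
    then show "V *\<^sub>v y \<noteq> 0\<^sub>v n \<and> eigval i (V\<^sup>T * S * V) * ((V *\<^sub>v y) \<bullet> (V *\<^sub>v y))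
        \<le> (V *\<^sub>v y) \<bullet> (S *\<^sub>v (V *\<^sub>v y))"
      using le by (simp add: orthonormal_cols_isometry[OF V y(1)] quadratic_form_mult_mat_vec[OF Sc Vc y(1)])
  qed
qed

text \<open>Interlacing bounds each eigenvalue of the compression by the corresponding eigenvalue of the
  pencil. The former sum to the trace 0 at the maximizer, the latter sum to at most 0 by maximality
  at the top eigenvectors, so all the inequalities are equalities.\<close>

lemma eigval_compression_maximizer:
  assumes A: "symmetric_real_mat n A" and B: "pos_def_mat n B" and k: "1 \<le> k" "k \<le> n"
    and sol: "trace_ratio_solution n k A B V r"
  shows "V \<in> orthonormal_cols n k"
    and "(\<Sum>i<k. eigval (Suc i) (A - r \<cdot>\<^sub>m B)) = 0"
    and "\<And>i. 1 \<le> i \<Longrightarrow> i \<le> k \<Longrightarrow> eigval i (V\<^sup>T * (A - r \<cdot>\<^sub>m B) * V) = eigval i (A - r \<cdot>\<^sub>m B)"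
proof -
  let ?M = "A - r \<cdot>\<^sub>m B" let ?N = "V\<^sup>T * ?M * V"
  have Ac: "A \<in> carrier_mat n n" using A by (simp add: symmetric_real_mat_def)
  have M: "symmetric_real_mat n ?M"
    using A B by (intro symmetric_real_mat_pencil) (simp_all add: pos_def_mat_def)
  note sol' = sol[unfolded trace_ratio_solution_def]
  note tr = solves_trace_ratio_mat_trace[OF Ac B k(1) order_refl sol']
  show V: "V \<in> orthonormal_cols n k"
    using sol' by (simp add: solves_trace_ratio_def is_arg_max_def)
  then have Vc: "V \<in> carrier_mat n k" by (simp add: orthonormal_cols_def)
  have le: "eigval (Suc i) ?N \<le> eigval (Suc i) ?M" if "i < k" for i
    using that k by (intro eigval_congruence_le[OF M V]) auto
  have N0: "(\<Sum>i<k. eigval (Suc i) ?N) = 0"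
    using mat_trace_eq_sum_eigval[OF symmetric_real_mat_congruence[OF M Vc]] tr(2) by simp
  have "(\<Sum>i<k. eigval (Suc i) ?M) \<le> 0"
    using ex_mat_trace_eq_sum_eigval[OF M k(2)] tr(1) by metis
  moreover have "(\<Sum>i<k. eigval (Suc i) ?N) \<le> (\<Sum>i<k. eigval (Suc i) ?M)"
    using le by (intro sum_mono) auto
  ultimately show M0: "(\<Sum>i<k. eigval (Suc i) ?M) = 0" using N0 by simp
  have "eigval (Suc i) ?N = eigval (Suc i) ?M" if "i < k" for i
  proof (rule sum_mono_inv[of "\<lambda>i. eigval (Suc i) ?N" "{..<k}" "\<lambda>i. eigval (Suc i) ?M"])
    show "(\<Sum>i<k. eigval (Suc i) ?N) = (\<Sum>i<k. eigval (Suc i) ?M)" using N0 M0 by simp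
  qed (use le that in auto)
  then show "eigval i ?N = eigval i ?M" if "1 \<le> i" "i \<le> k" for i
    using that by (cases i) auto
qed

section \<open>Two-sided bounds for the eigenvalues of the projected pencil\<close>

text \<open>The form of the pencil at \<open>r\<close> exceeds the one at \<open>r'\<close> by r' -
  r times the form of \<open>B\<close>, and r \<le> r' allows the latter to be replaced by its bound
  |B| |u|^2. The rest is interlacing along \<open>U\<close>.\<close>

lemma projected_pencil_eigval_upper:
  assumes A: "symmetric_real_mat n A" and B: "symmetric_real_mat n B" and U: "U \<in> orthonormal_cols n j"
    and r: "r \<le> r'" and i: "1 \<le> i" "i \<le> j" "i \<le> n"
  shows "eigval i (U\<^sup>T * (A - r \<cdot>\<^sub>m B) * U) \<le> eigval i (A - r' \<cdot>\<^sub>m B) + (r' - r) * spectral_norm B"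
proof -
  let ?N = "U\<^sup>T * (A - r \<cdot>\<^sub>m B) * U"
  have Ac: "A \<in> carrier_mat n n" and Bc: "B \<in> carrier_mat n n" and Uc: "U \<in> carrier_mat n j"
    using A B U by (auto simp: symmetric_real_mat_def orthonormal_cols_def)
  have M: "symmetric_real_mat n (A - r \<cdot>\<^sub>m B)" "symmetric_real_mat n (A - r' \<cdot>\<^sub>m B)"
    using A B by (auto intro: symmetric_real_mat_pencil)
  then have Mc: "A - r \<cdot>\<^sub>m B \<in> carrier_mat n n" by (simp add: symmetric_real_mat_def)
  have "eigval i ?N - (r' - r) * spectral_norm B \<le> eigval i (A - r' \<cdot>\<^sub>m B)"
  proof (rule eigval_le_of_form_le[OF M(2) symmetric_real_mat_congruence[OF M(1) Uc] Uc i])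
    fix y :: "real vec" assume y: "y \<in> carrier_vec j" "y \<noteq> 0\<^sub>v j"
      and le: "eigval i ?N * (y \<bullet> y) \<le> y \<bullet> (?N *\<^sub>v y)"
    define u where "u = U *\<^sub>v y"
    have u: "u \<in> carrier_vec n" using Uc y by (simp add: u_def)
    have uu: "u \<bullet> u = y \<bullet> y" unfolding u_def by (rule orthonormal_cols_isometry[OF U y(1)])
    have u0: "u \<noteq> 0\<^sub>v n" using scalar_prod_self_pos[OF y] uu by auto
    have 1: "eigval i ?N * (u \<bullet> u) \<le> u \<bullet> (A *\<^sub>v u) - r * (u \<bullet> (B *\<^sub>v u))"
      using le uu by (simp add: pencil_form[OF Ac Bc u, symmetric])
        (simp add: u_def quadratic_form_mult_mat_vec[OF Mc Uc y(1)])
    have "u \<bullet> (B *\<^sub>v u) \<le> spectral_norm B * (u \<bullet> u)"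
      using abs_bilinear_form_le[OF Bc u u] by (simp add: mult.assoc power2_eq_square flip: euclid_norm_power2)
    then have "(r' - r) * (u \<bullet> (B *\<^sub>v u)) \<le> (r' - r) * (spectral_norm B * (u \<bullet> u))"
      using r by (intro mult_left_mono) auto
    with 1 have "(eigval i ?N - (r' - r) * spectral_norm B) * (u \<bullet> u) \<le> u \<bullet> ((A - r' \<cdot>\<^sub>m B) *\<^sub>v u)"
      unfolding pencil_form[OF Ac Bc u] by (simp add: algebra_simps)
    then show "U *\<^sub>v y \<noteq> 0\<^sub>v n \<and> (eigval i ?N - (r' - r) * spectral_norm B) * ((U *\<^sub>v y) \<bullet> (U *\<^sub>v y))
        \<le> (U *\<^sub>v y) \<bullet> ((A - r' \<cdot>\<^sub>m B) *\<^sub>v (U *\<^sub>v y))"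
      using u0 by (simp add: u_def)
  qed
  then show ?thesis by simp
qed

text \<open>For x = V z the vector y = U^T V z holds the coordinates of the projection u = U y, and
  |x - u| \<le> s |x| by the choice of s. Passing from r' to r adds r' - r times the form of B at u,
  at least (r' - r) b |u|^2; this gain is kept because it later bounds r' - r itself.\<close>

lemma projected_pencil_eigval_lower:
  fixes V :: "real mat"
  assumes A: "symmetric_real_mat n A" and B: "symmetric_real_mat n B"
    and b: "\<And>x. x \<in> carrier_vec n \<Longrightarrow> b * (x \<bullet> x) \<le> x \<bullet> (B *\<^sub>v x)"
    and U: "U \<in> orthonormal_cols n j" and U': "U' \<in> orthonormal_cols n m"
    and compl: "vec_space.col_space n U' = orth_complement n (vec_space.col_space n U)"
    and V: "V \<in> orthonormal_cols n k" and s: "spectral_norm (U'\<^sup>T * V) = s" "s \<le> 1 / 2"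
    and r: "r \<le> r'" and i: "1 \<le> i" "i \<le> k" "i \<le> j"
  defines "c \<equiv> eigval i (V\<^sup>T * (A - r' \<cdot>\<^sub>m B) * V)"
  shows "c - (4 * spectral_norm (A - r' \<cdot>\<^sub>m B) + 2 * \<bar>c\<bar>) * s + (r' - r) * b
    \<le> eigval i (U\<^sup>T * (A - r \<cdot>\<^sub>m B) * U)"
proof -
  let ?N = "U\<^sup>T * (A - r \<cdot>\<^sub>m B) * U"
  let ?L = "4 * spectral_norm (A - r' \<cdot>\<^sub>m B) + 2 * \<bar>c\<bar>"
  have Ac: "A \<in> carrier_mat n n" and Bc: "B \<in> carrier_mat n n" and Uc: "U \<in> carrier_mat n j"
    and Vc: "V \<in> carrier_mat n k" and U'c: "U' \<in> carrier_mat n m"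
    using A B U V U' by (auto simp: symmetric_real_mat_def orthonormal_cols_def)
  have M: "symmetric_real_mat n (A - r \<cdot>\<^sub>m B)" "symmetric_real_mat n (A - r' \<cdot>\<^sub>m B)"
    using A B by (auto intro: symmetric_real_mat_pencil)
  then have Mc: "A - r \<cdot>\<^sub>m B \<in> carrier_mat n n" "A - r' \<cdot>\<^sub>m B \<in> carrier_mat n n"
    by (auto simp: symmetric_real_mat_def)
  have T: "U\<^sup>T * V \<in> carrier_mat j k" using Uc Vc by simp
  have s0: "0 \<le> s" using s(1) spectral_norm_nonneg by blast
  show ?thesis
  proof (rule eigval_le_of_form_le[OF symmetric_real_mat_congruence[OF M(1) Uc]
        symmetric_real_mat_congruence[OF M(2) Vc] T i])
    fix z :: "real vec" assume z: "z \<in> carrier_vec k" "z \<noteq> 0\<^sub>v k"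
      and le: "eigval i (V\<^sup>T * (A - r' \<cdot>\<^sub>m B) * V) * (z \<bullet> z) \<le> z \<bullet> ((V\<^sup>T * (A - r' \<cdot>\<^sub>m B) * V) *\<^sub>v z)"
    define x where "x = V *\<^sub>v z"
    have x: "x \<in> carrier_vec n" using Vc z by (simp add: x_def)
    have xx: "x \<bullet> x = z \<bullet> z" unfolding x_def by (rule orthonormal_cols_isometry[OF V z(1)])
    have form: "c * (x \<bullet> x) \<le> x \<bullet> ((A - r' \<cdot>\<^sub>m B) *\<^sub>v x)"
      using le unfolding xx by (simp add: c_def x_def quadratic_form_mult_mat_vec[OF Mc(2) Vc z(1)])
    define y where "y = U\<^sup>T *\<^sub>v x"
    define u where "u = U *\<^sub>v y"
    have y: "y \<in> carrier_vec j" using Uc x by (simp add: y_def)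
    have u: "u \<in> carrier_vec n" using Uc y by (simp add: u_def)
    have uu: "u \<bullet> u = y \<bullet> y" unfolding u_def by (rule orthonormal_cols_isometry[OF U y])
    have Tz: "U\<^sup>T * V *\<^sub>v z = y" using Uc Vc z(1) by (simp add: y_def x_def assoc_mult_mat_vec[of _ j n _ k])
    note res = orthogonal_projection_residual[OF U U' compl x, folded y_def u_def]
    have "U'\<^sup>T *\<^sub>v x = U'\<^sup>T * V *\<^sub>v z"
      using U'c Vc z(1) by (simp add: x_def assoc_mult_mat_vec[of _ m n _ k])
    then have near: "euclid_norm (x - u) \<le> s * euclid_norm x"
      using euclid_norm_mult_mat_vec_le[of "U'\<^sup>T * V" m k z] U'c Vc z(1)
      by (simp add: res(1) s(1)) (simp add: euclid_norm_def xx)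
    note pert = rayleigh_perturbation[OF M(2) x u res(2) near s0 s(2) form]
    \<comment> \<open>A residual of at most half the length of \<open>x\<close> keeps the projection
      nonzero, as the comparison demands.\<close>
    have "0 < y \<bullet> y" using pert(2) scalar_prod_self_pos[OF z] by (simp add: xx uu)
    then have y0: "y \<noteq> 0\<^sub>v j" by auto
    have "(r' - r) * (b * (u \<bullet> u)) \<le> (r' - r) * (u \<bullet> (B *\<^sub>v u))"
      using r b[OF u] by (intro mult_left_mono) auto
    with pert(1) have "(c - ?L * s + (r' - r) * b) * (u \<bullet> u) \<le> u \<bullet> ((A - r \<cdot>\<^sub>m B) *\<^sub>v u)"
      unfolding pencil_form[OF Ac Bc u] by (simp add: algebra_simps)
    also have "\<dots> = y \<bullet> (?N *\<^sub>v y)" unfolding u_def by (rule quadratic_form_mult_mat_vec[OF Mc(1) Uc y])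
    finally show "U\<^sup>T * V *\<^sub>v z \<noteq> 0\<^sub>v j \<and> (c - ?L * s + (r' - r) * b) * ((U\<^sup>T * V *\<^sub>v z) \<bullet> (U\<^sup>T * V *\<^sub>v z))
        \<le> (U\<^sup>T * V *\<^sub>v z) \<bullet> (?N *\<^sub>v (U\<^sup>T * V *\<^sub>v z))"
      using y0 by (simp add: Tz uu)
  qed
qed

lemma projected_trace_ratio_max_le:
  assumes sol: "trace_ratio_solution n k A B V r'" and proj: "projected_trace_ratio_max n k A B U r"
  shows "r \<le> r'"
  using sol proj
  by (auto simp: trace_ratio_solution_def projected_trace_ratio_max_def solves_trace_ratio_def is_arg_max_def not_less)

text \<open>If the columns of Z are top \<open>k\<close> eigenvectors of the projected pencil, then
  U Z is feasible for the projected problem and the trace of the pencil at U Z is the sum in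
  question.\<close>

lemma projected_pencil_sum_eigval_le:
  assumes A: "symmetric_real_mat n A" and B: "pos_def_mat n B" and k: "1 \<le> k" "k \<le> j"
    and U: "U \<in> orthonormal_cols n j" and proj: "projected_trace_ratio_max n k A B U r"
  shows "(\<Sum>i<k. eigval (Suc i) (U\<^sup>T * (A - r \<cdot>\<^sub>m B) * U)) \<le> 0"
proof -
  let ?M = "A - r \<cdot>\<^sub>m B"
  let ?F = "{V \<in> orthonormal_cols n k. \<exists>Z \<in> carrier_mat (dim_col U) k. V = U * Z}"
  have Ac: "A \<in> carrier_mat n n" and Uc: "U \<in> carrier_mat n j"
    using A U by (auto simp: symmetric_real_mat_def orthonormal_cols_def)
  have M: "symmetric_real_mat n ?M"
    using A B by (intro symmetric_real_mat_pencil) (simp_all add: pos_def_mat_def)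
  then have Mc: "?M \<in> carrier_mat n n" by (simp add: symmetric_real_mat_def)
  obtain V where "solves_trace_ratio A B ?F V r"
    using proj by (auto simp: projected_trace_ratio_max_def)
  note tr = solves_trace_ratio_mat_trace(1)[OF Ac B k(1) _ this]
  obtain Z where Z: "Z \<in> orthonormal_cols j k"
    "mat_trace (Z\<^sup>T * (U\<^sup>T * ?M * U) * Z) = (\<Sum>i<k. eigval (Suc i) (U\<^sup>T * ?M * U))"
    using ex_mat_trace_eq_sum_eigval[OF symmetric_real_mat_congruence[OF M Uc] k(2)] by auto
  have Zc: "Z \<in> carrier_mat j k" using Z(1) by (simp add: orthonormal_cols_def)
  have "U * Z \<in> ?F" using orthonormal_cols_mult[OF U Z(1)] Uc Zc by auto
  then have "mat_trace ((U * Z)\<^sup>T * ?M * (U * Z)) \<le> 0" by (intro tr) auto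
  then show ?thesis unfolding congruence_mult[OF Mc Uc Zc] Z(2) .
qed

theorem corollary7:
  fixes A B Vstar :: "real mat" and rstar :: real and p k :: nat
  assumes "symmetric_real_mat p A"
    and "pos_def_mat p B"
    and "1 \<le> k" and "k < p"
    and "trace_ratio_solution p k A B Vstar rstar"
    and "eigval k (A - rstar \<cdot>\<^sub>m B) > eigval (k + 1) (A - rstar \<cdot>\<^sub>m B)"
  shows "\<forall>\<epsilon>>0. \<exists>\<delta>>0. \<forall>j U r \<theta>.
    k \<le> j \<longrightarrow> j \<le> p \<longrightarrow> U \<in> orthonormal_cols p j \<longrightarrow>
    projected_trace_ratio_max p k A B U r \<longrightarrow>
    subspace_angle p U Vstar \<theta> \<longrightarrow> \<theta> < \<delta> \<longrightarrow>
    (let H = transpose_mat U * A * U; K = transpose_mat U * B * U in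
      \<exists>\<pi> :: nat \<Rightarrow> nat. inj_on \<pi> {1..k} \<and> \<pi> ` {1..k} \<subseteq> {1..j} \<and>
        (\<forall>i \<in> {1..k}. \<bar>eigval (\<pi> i) (H - r \<cdot>\<^sub>m K) - eigval i (A - rstar \<cdot>\<^sub>m B)\<bar> < \<epsilon>))"
proof (intro allI impI)
  fix \<epsilon> :: real assume \<epsilon>: "0 < \<epsilon>"
  let ?M = "A - rstar \<cdot>\<^sub>m B"
  note A = assms(1) and B = assms(2) and k = assms(3,4) and sol = assms(5)
  have Bs: "symmetric_real_mat p B" using B by (simp add: pos_def_mat_def)
  have Ac: "A \<in> carrier_mat p p" and Bc: "B \<in> carrier_mat p p"
    using A Bs by (simp_all add: symmetric_real_mat_def)
  obtain b where b: "0 < b" "\<And>x. x \<in> carrier_vec p \<Longrightarrow> b * (x \<bullet> x) \<le> x \<bullet> (B *\<^sub>v x)"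
    using pos_def_mat_form_ge[OF B] k by auto
  note V = eigval_compression_maximizer[OF A B k(1) less_imp_le[OF k(2)] sol]
  \<comment> \<open>Summing over all indices gives one constant that dominates 4 |M| + 2 |lambda_i|
    for every i \<le> \<open>k\<close>.\<close>
  define L where "L = 4 * spectral_norm ?M + 2 * (\<Sum>i<k. \<bar>eigval (Suc i) ?M\<bar>)"
  define \<beta> where "\<beta> = spectral_norm B"
  \<comment> \<open>The lower error will be \<open>L * s\<close> and the upper error
    \<open>d * \<beta>\<close>, at most \<open>L / b * \<beta> * s\<close>; \<open>C\<close>
    dominates both coefficients.\<close>
  define C where "C = L * (1 + \<beta> / b)"
  have L: "0 \<le> L" using spectral_norm_nonneg[of ?M] by (simp add: L_def sum_nonneg)
  have \<beta>: "0 \<le> \<beta>" by (simp add: \<beta>_def spectral_norm_nonneg)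
  have C: "L \<le> C" "0 \<le> C" "L / b * \<beta> \<le> C" using L \<beta> b(1) by (auto simp: C_def field_simps)
  \<comment> \<open>The bound 1/2 brings \<open>s\<close> into the range of the perturbation
    estimate; \<open>C + 1\<close> in place of \<open>C\<close> excludes a zero denominator.\<close>
  define \<delta> where "\<delta> = min (1 / 2) (\<epsilon> / (C + 1))"
  have \<delta>: "0 < \<delta>" using C(2) \<epsilon> by (simp add: \<delta>_def)
  show "\<exists>\<delta>>0. \<forall>j U r \<theta>.
    k \<le> j \<longrightarrow> j \<le> p \<longrightarrow> U \<in> orthonormal_cols p j \<longrightarrow>
    projected_trace_ratio_max p k A B U r \<longrightarrow>
    subspace_angle p U Vstar \<theta> \<longrightarrow> \<theta> < \<delta> \<longrightarrow>
    (let H = transpose_mat U * A * U; K = transpose_mat U * B * U in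
      \<exists>\<pi> :: nat \<Rightarrow> nat. inj_on \<pi> {1..k} \<and> \<pi> ` {1..k} \<subseteq> {1..j} \<and>
        (\<forall>i \<in> {1..k}. \<bar>eigval (\<pi> i) (H - r \<cdot>\<^sub>m K) - eigval i (A - rstar \<cdot>\<^sub>m B)\<bar> < \<epsilon>))"
  proof (intro exI[of _ \<delta>] conjI \<delta> allI impI)
    fix j U r \<theta>
    assume j: "k \<le> j" "j \<le> p" and U: "U \<in> orthonormal_cols p j"
      and proj: "projected_trace_ratio_max p k A B U r"
      and ang: "subspace_angle p U Vstar \<theta>" and \<theta>: "\<theta> < \<delta>"
    let ?N = "U\<^sup>T * (A - r \<cdot>\<^sub>m B) * U"
    have Uc: "U \<in> carrier_mat p j" using U by (simp add: orthonormal_cols_def)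
    obtain m U' where U': "U' \<in> orthonormal_cols p m"
      "vec_space.col_space p U' = orth_complement p (vec_space.col_space p U)"
      and sin: "spectral_norm (U'\<^sup>T * Vstar) = sin \<theta>" and \<theta>0: "0 \<le> \<theta>"
      using ang unfolding subspace_angle_def by metis
    define s where "s = sin \<theta>"
    have s: "0 \<le> s" "s \<le> \<theta>"
      using spectral_norm_nonneg[of "U'\<^sup>T * Vstar"] sin_x_le_x[OF \<theta>0] by (simp_all add: s_def sin)
    have s2: "s \<le> 1 / 2" using s \<theta> by (simp add: \<delta>_def)
    define d where "d = rstar - r"
    have r: "r \<le> rstar" by (rule projected_trace_ratio_max_le[OF sol proj])
    then have d: "0 \<le> d" by (simp add: d_def)
    have upper: "eigval i ?N \<le> eigval i ?M + d * \<beta>" if "1 \<le> i" "i \<le> k" for i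
      unfolding d_def \<beta>_def using that j
      by (intro projected_pencil_eigval_upper[OF A Bs U r]) auto
    have lower: "eigval i ?M - L * s + d * b \<le> eigval i ?N" if i: "1 \<le> i" "i \<le> k" for i
    proof -
      have "\<bar>eigval (Suc (i - 1)) ?M\<bar> \<le> (\<Sum>i<k. \<bar>eigval (Suc i) ?M\<bar>)"
        using i by (intro member_le_sum[of "i - 1" "{..<k}" "\<lambda>i. \<bar>eigval (Suc i) ?M\<bar>"]) auto
      then have "(4 * spectral_norm ?M + 2 * \<bar>eigval i ?M\<bar>) * s \<le> L * s"
        using i s(1) unfolding L_def by (intro mult_right_mono) auto
      then show ?thesis
        using projected_pencil_eigval_lower[OF A Bs b(2) U U' V(1) sin[folded s_def] s2 r i(1,2)] i j
        unfolding V(3)[OF i] d_def by linarith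
    qed
    \<comment> \<open>Here \<open>d\<close> gets its bound: the eigenvalues of \<open>?M\<close> sum
      to 0, so the summed lower bounds leave only \<open>k\<close> equal copies of
      \<open>d * b - L * s\<close>, whose total is at most 0.\<close>
    have "(\<Sum>i<k. eigval (Suc i) ?M + (d * b - L * s)) \<le> (\<Sum>i<k. eigval (Suc i) ?N)"
      using lower by (intro sum_mono) (simp add: algebra_simps)
    also have "\<dots> \<le> 0" by (rule projected_pencil_sum_eigval_le[OF A B k(1) j(1) U proj])
    finally have "real k * (d * b - L * s) \<le> 0" by (simp add: sum.distrib V(2))
    then have "d * b \<le> L * s" using k(1) by (simp add: mult_le_0_iff)
    then have "d \<le> L / b * s" using b(1) by (simp add: field_simps)
    then have "d * \<beta> \<le> L / b * s * \<beta>" using \<beta> by (rule mult_right_mono)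
    also have "\<dots> = L / b * \<beta> * s" by simp
    also have "\<dots> \<le> C * s" using C(3) s(1) by (rule mult_right_mono)
    finally have d\<beta>: "d * \<beta> \<le> C * s" .
    have Ls: "L * s \<le> C * s" using C(1) s(1) by (rule mult_right_mono)
    have "C * s \<le> (C + 1) * \<theta>" using s C(2) \<theta>0 by (intro mult_mono) auto
    also have "\<dots> < (C + 1) * (\<epsilon> / (C + 1))"
      using \<theta> C(2) by (intro mult_strict_left_mono) (auto simp: \<delta>_def)
    also have "\<dots> = \<epsilon>" using C(2) by simp
    finally have Cs: "C * s < \<epsilon>" .
    have "\<bar>eigval i ?N - eigval i ?M\<bar> < \<epsilon>" if "i \<in> {1..k}" for i
    proof -
      \<comment> \<open>Having served to bound \<open>d\<close>, the gain \<open>d * b\<close> is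
        dropped from the lower bound.\<close>
      have "0 \<le> d * b" using d b(1) by simp
      then show ?thesis using upper[of i] lower[of i] that d\<beta> Ls Cs by auto
    qed
    then show "let H = transpose_mat U * A * U; K = transpose_mat U * B * U in
      \<exists>\<pi> :: nat \<Rightarrow> nat. inj_on \<pi> {1..k} \<and> \<pi> ` {1..k} \<subseteq> {1..j} \<and>
        (\<forall>i \<in> {1..k}. \<bar>eigval (\<pi> i) (H - r \<cdot>\<^sub>m K) - eigval i (A - rstar \<cdot>\<^sub>m B)\<bar> < \<epsilon>)"
      unfolding Let_def congruence_pencil[OF Ac Bc Uc, symmetric] using j
      by (intro exI[of _ "\<lambda>i. i"]) auto
  qed
qed

end
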